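(* Let $\rho(s)=\arcsin(s)$, $\psi_0(\theta)=\cos\theta$, and $\psi_s(\theta)=\frac{1}{\arcsin(s)}\arcsin(s\cos\theta)$ for $0<s<1$, and let $d\mu_t(k)$ be the probability measure on $\mathbb{R}$ associated with a continuous real-valued function $k$ on $S^1$ (defined in the context). For $(s,u)\in[0,1)\times[0,\infty)$ define the probability measure $d\mu_{(s,u)}$ on $\mathbb{R}$ by $$d\mu_{(s,u)}=\begin{cases} d\mu_{1/u}(\psi_s) & (0\le s<1,\ 0<u),\\[4pt] \dfrac{\rho(s)\sqrt{1-s^2}}{\pi(1-\rho(s)^2x^2)\sqrt{s^2-\rho(s)^2x^2}}\,\chi_{(-s/\rho(s),\,s/\rho(s))}(x)\,dx & (0<s<1,\ u=0),\\[8pt] \dfrac{1}{\pi\sqrt{1-x^2}}\,\chi_{(-1,1)}(x)\,dx & (s=u=0).\end{cases}$$ Then the map $(s,u)\mapsto d\mu_{(s,u)}$ is a continuous map from $[0,1)\times[0,\infty)$ to the space of all probability measures on $\mathbb{R}$ equipped with the weak topology. In particular, weakly, $$\lim_{(s,1/t)\to(0,0)}d\mu_t(\psi_s)=\frac{1}{\pi\sqrt{1-x^2}}\,\chi_{(-1,1)}(x)\,dx.$$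
   Context: $\arcsin$ denotes the principal value in $[-\pi/2,\pi/2]$; $\chi_I$ is the indicator function of an interval $I$. Functions on the unit circle $S^1$ are identified with $2\pi$-periodic functions of $\theta\in\mathbb{R}$; $L^2(S^1)$ is taken with respect to the uniform probability measure $d\theta/2\pi$. The Fourier transform $\mathcal{F}:L^2(S^1)\to\ell^2(\mathbb{Z})$ is the unitary operator $\mathcal{F}(k)(x)=\frac{1}{2\pi}\int_0^{2\pi}e^{-ix\theta}k(\theta)\,d\theta$. For a continuous real-valued function $k$ on $S^1$, $M(k)$ is the operator of multiplication by $k$ on $L^2(S^1)$, and $\widehat{H}(k)=\mathcal{F}M(k)\mathcal{F}^*$, a bounded self-adjoint operator on $\ell^2(\mathbb{Z})$. For $t\in\mathbb{R}$ and $x\in\mathbb{Z}$ set $$p_t(k;x)=|\langle e^{it\widehat{H}(k)}\delta_0,\delta_x\rangle|^2,$$ where $\langle\cdot,\cdot\rangle$ is the standard inner product on $\ell^2(\mathbb{Z})$ and $\delta_x\in\ell^2(\mathbb{Z})$ is the function equal to $1$ at $x$ and $0$ elsewhere; $\{p_t(k;x)\}_{x\in\mathbb{Z}}$ is a probability distribution. For $t\neq 0$ define the probability measure on $\mathbb{R}$ $$d\mu_t(k)=\sum_{x\in\mathbb{Z}}p_t(k;x)\,\delta_{x/t},$$ where $\delta_\xi$ for $\xi\in\mathbb{R}$ here denotes the Dirac measure at $\xi$. *)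

theory Defs
  imports "HOL-Probability.Probability"
begin

text \<open>Functions on the circle are \<open>2\<pi>\<close>-periodic functions on the reals. Elements of \<open>L\<^sup>2\<close> are
  represented by Borel functions; equality almost everywhere is not quotiented out, and
  the operators below depend on a representative only up to null sets.\<close>

definition circle_L2 :: "(real \<Rightarrow> complex) set" where
  "circle_L2 = {g \<in> borel_measurable borel.
     (\<forall>\<theta>. g (\<theta> + 2 * pi) = g \<theta>) \<and>
     set_integrable lborel {0..2 * pi} (\<lambda>\<theta>. (cmod (g \<theta>))\<^sup>2)}"

definition circle_inner :: "(real \<Rightarrow> complex) \<Rightarrow> (real \<Rightarrow> complex) \<Rightarrow> complex" where
  "circle_inner g h =
     1 / (2 * pi) * set_lebesgue_integral lborel {0..2 * pi} (\<lambda>\<theta>. g \<theta> * cnj (h \<theta>))"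

definition ell2 :: "(int \<Rightarrow> complex) set" where
  "ell2 = {v. (\<lambda>x. (cmod (v x))\<^sup>2) summable_on UNIV}"

definition ell2_inner :: "(int \<Rightarrow> complex) \<Rightarrow> (int \<Rightarrow> complex) \<Rightarrow> complex" where
  "ell2_inner v w = (\<Sum>\<^sub>\<infinity>x. v x * cnj (w x))"

definition ell2_norm :: "(int \<Rightarrow> complex) \<Rightarrow> real" where
  "ell2_norm v = sqrt (\<Sum>\<^sub>\<infinity>x. (cmod (v x))\<^sup>2)"

definition ell2_tendsto :: "(nat \<Rightarrow> int \<Rightarrow> complex) \<Rightarrow> (int \<Rightarrow> complex) \<Rightarrow> bool" where
  "ell2_tendsto S w \<longleftrightarrow> (\<forall>N. S N \<in> ell2) \<and> w \<in> ell2 \<and>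
     (\<lambda>N. ell2_norm (\<lambda>x. S N x - w x)) \<longlonglongrightarrow> 0"

definition ell2_delta :: "int \<Rightarrow> int \<Rightarrow> complex" where
  "ell2_delta x y = (if y = x then 1 else 0)"

definition fourier :: "(real \<Rightarrow> complex) \<Rightarrow> int \<Rightarrow> complex" where
  "fourier g x = 1 / (2 * pi) *
     set_lebesgue_integral lborel {0..2 * pi} (\<lambda>\<theta>. exp (- \<i> * of_int x * of_real \<theta>) * g \<theta>)"

text \<open>The Hilbert space adjoint of the Fourier transform; the defining property determines the
  value up to a null set, so the choice of representative is immaterial.\<close>

definition fourier_adj :: "(int \<Rightarrow> complex) \<Rightarrow> real \<Rightarrow> complex" where
  "fourier_adj v = (SOME g. g \<in> circle_L2 \<and>
     (\<forall>h\<in>circle_L2. ell2_inner (fourier h) v = circle_inner h g))"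

definition mult_op :: "(real \<Rightarrow> real) \<Rightarrow> (real \<Rightarrow> complex) \<Rightarrow> real \<Rightarrow> complex" where
  "mult_op k g \<theta> = of_real (k \<theta>) * g \<theta>"

definition H_hat :: "(real \<Rightarrow> real) \<Rightarrow> (int \<Rightarrow> complex) \<Rightarrow> int \<Rightarrow> complex" where
  "H_hat k v = fourier (mult_op k (fourier_adj v))"

text \<open>The exponential of a bounded operator, applied to a vector: the limit of the
  exponential series in the \<open>\<ell>\<^sup>2\<close> norm.\<close>

definition exp_op ::
  "((int \<Rightarrow> complex) \<Rightarrow> int \<Rightarrow> complex) \<Rightarrow> (int \<Rightarrow> complex) \<Rightarrow> int \<Rightarrow> complex" where
  "exp_op A v = (THE w. ell2_tendsto (\<lambda>N x. \<Sum>n<N. (A ^^ n) v x / fact n) w)"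

definition walk_prob :: "real \<Rightarrow> (real \<Rightarrow> real) \<Rightarrow> int \<Rightarrow> real" where
  "walk_prob t k x =
     (cmod (ell2_inner (exp_op (\<lambda>v y. \<i> * of_real t * H_hat k v y) (ell2_delta 0)) (ell2_delta x)))\<^sup>2"

text \<open>The sum of the point masses \<open>walk_prob t k x\<close> at \<open>x / t\<close>, as the push-forward of the measure
  on the integers with these weights.\<close>

definition walk_measure :: "real \<Rightarrow> (real \<Rightarrow> real) \<Rightarrow> real measure" where
  "walk_measure t k =
     distr (density (count_space UNIV) (\<lambda>x. ennreal (walk_prob t k x))) borel
       (\<lambda>x::int. of_int x / t)"

definition psi :: "real \<Rightarrow> real \<Rightarrow> real" where
  "psi s \<theta> = (if s = 0 then cos \<theta> else arcsin (s * cos \<theta>) / arcsin s)"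

definition arcsine_measure :: "real measure" where
  "arcsine_measure = density lborel
     (\<lambda>x. ennreal (1 / (pi * sqrt (1 - x\<^sup>2)) * indicator {-1<..<1} x))"

definition limit_measure :: "real \<Rightarrow> real measure" where
  "limit_measure s = density lborel
     (\<lambda>x. ennreal (arcsin s * sqrt (1 - s\<^sup>2) /
       (pi * (1 - (arcsin s)\<^sup>2 * x\<^sup>2) * sqrt (s\<^sup>2 - (arcsin s)\<^sup>2 * x\<^sup>2)) *
       indicator {- s / arcsin s<..<s / arcsin s} x))"

definition mu :: "real \<Rightarrow> real \<Rightarrow> real measure" where
  "mu s u = (if 0 < u then walk_measure (1 / u) (psi s)
             else if 0 < s then limit_measure s
             else arcsine_measure)"

definition borel_prob_measures :: "real measure set" where
  "borel_prob_measures = {M. prob_space M \<and> sets M = sets borel}"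

text \<open>The coarsest topology making \<open>M \<mapsto> \<integral>f dM\<close> continuous for every bounded continuous \<open>f\<close>.\<close>

definition weak_topology :: "real measure topology" where
  "weak_topology = topology_generated_by
     {{M \<in> borel_prob_measures. (\<integral>x. f x \<partial>M) \<in> U} | f U.
        continuous_on UNIV f \<and> bounded (range f) \<and> open (U :: real set)}"

lemma topspace_weak_topology: "topspace weak_topology = borel_prob_measures"
proof -
  have "borel_prob_measures =
      {M \<in> borel_prob_measures. (\<integral>x. (\<lambda>_. 0 :: real) x \<partial>M) \<in> UNIV}"
    by simp
  moreover have "continuous_on UNIV (\<lambda>_::real. 0 :: real)" "bounded (range (\<lambda>_::real. 0 :: real))"
    by auto
  ultimately show ?thesis
    unfolding weak_topology_def topology_generated_by_topspace by blast
qed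

end

theory Submission
  imports Defs
begin

text \<open>The Fourier transform turns the operator \<open>H_hat k\<close> into multiplication by \<open>k\<close>. The walk at time \<open>t\<close>
  is therefore the sequence of Fourier coefficients of \<open>g = exp (i t k)\<close> (\<open>walk_prob_eq_fourier\<close>), and by
  Parseval's identity the characteristic function of its rescaled law at \<open>\<xi>\<close> is the mean over the circle of
  \<open>exp (i t (k (\<theta> + \<xi> / t) - k \<theta>))\<close> (\<open>char_walk_measure\<close>).

  For \<open>k = psi s\<close> and \<open>u = 1 / t\<close> the exponent contains the difference quotient of \<open>psi s\<close> with step
  \<open>\<xi> u\<close>. It equals \<open>\<xi>\<close> times the average of the derivative of \<open>psi s\<close>, the group velocity, over the
  segment from \<open>\<theta>\<close> to \<open>\<theta> + \<xi> u\<close> (\<open>psi_difference_quotient\<close>). The group velocity is jointly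
  continuous in \<open>s\<close> and \<open>\<theta>\<close>, including at \<open>s = 0\<close>, so this average has no singularity at \<open>u = 0\<close>, and
  the mean over the circle is continuous in \<open>(s, u)\<close> up to the boundary (\<open>continuous_on_mu_char\<close>).

  At \<open>u = 0\<close> the mean is the characteristic function of the group velocity at a uniformly
  distributed \<open>\<theta>\<close>. A change of variables shows that the law of this random variable has the given
  density (\<open>velocity_substitution\<close>, \<open>mu_zero_eq_distr\<close>). One formula thus describes the characteristic
  functions of all the measures (\<open>char_mu\<close>), and Levy's continuity theorem translates its continuity
  into weak continuity. The limit statement is continuity at \<open>(0, 0)\<close>.\<close>

section \<open>The Hilbert space of the circle\<close>

definition circle_C :: "(real \<Rightarrow> complex) set" where
  "circle_C = {g. continuous_on UNIV g \<and> (\<forall>\<theta>. g (\<theta> + 2 * pi) = g \<theta>)}"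

definition harmonic :: "int \<Rightarrow> real \<Rightarrow> complex" where
  "harmonic n \<theta> = cis (of_int n * \<theta>)"

text \<open>The squared norm of \<open>L\<^sup>2(S\<^sup>1)\<close>, as a real number. It is used in place of the norm because
  every estimate below is a comparison of squares.\<close>

definition circle_sq :: "(real \<Rightarrow> complex) \<Rightarrow> real" where
  "circle_sq f = 1 / (2 * pi) * set_lebesgue_integral lborel {0..2 * pi} (\<lambda>\<theta>. (cmod (f \<theta>))\<^sup>2)"

definition fourier_sum :: "(real \<Rightarrow> complex) \<Rightarrow> int set \<Rightarrow> real \<Rightarrow> complex" where
  "fourier_sum g F \<theta> = (\<Sum>n\<in>F. fourier g n * harmonic n \<theta>)"

lemma circle_C_sum:
  "(\<And>i. i \<in> I \<Longrightarrow> f i \<in> circle_C) \<Longrightarrow> (\<lambda>\<theta>. \<Sum>i\<in>I. f i \<theta>) \<in> circle_C"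
  by (auto simp: circle_C_def intro!: continuous_intros)

lemma circle_C_mult: "f \<in> circle_C \<Longrightarrow> g \<in> circle_C \<Longrightarrow> (\<lambda>\<theta>. f \<theta> * g \<theta>) \<in> circle_C"
  by (auto simp: circle_C_def intro!: continuous_intros)

lemma circle_C_diff: "f \<in> circle_C \<Longrightarrow> g \<in> circle_C \<Longrightarrow> (\<lambda>\<theta>. f \<theta> - g \<theta>) \<in> circle_C"
  by (auto simp: circle_C_def intro!: continuous_intros)

lemma circle_C_const: "(\<lambda>_. c) \<in> circle_C"
  by (auto simp: circle_C_def)

lemma circle_C_harmonic: "harmonic n \<in> circle_C"
proof -
  have "cis (of_int n * (\<theta> + 2 * pi)) = cis (of_int n * \<theta>)" for \<theta>
  proof -
    have "cis (of_int n * (\<theta> + 2 * pi)) = cis (of_int n * \<theta>) * cis (2 * pi * of_int n)"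
      by (simp add: cis_mult algebra_simps)
    also have "cis (2 * pi * of_int n) = 1"
      by (rule cis_multiple_2pi) auto
    finally show ?thesis by simp
  qed
  then show ?thesis
    by (auto simp: circle_C_def harmonic_def cis_conv_exp intro!: continuous_intros)
qed

lemma circle_C_integrable:
  "f \<in> circle_C \<Longrightarrow> set_integrable lborel {a..b} f"
  by (rule borel_integrable_atLeastAtMost') (auto simp: circle_C_def intro: continuous_on_subset)

lemma circle_C_L2:
  assumes "f \<in> circle_C"
  shows "f \<in> circle_L2"
proof -
  have c: "continuous_on UNIV f" using assms by (simp add: circle_C_def)
  have "continuous_on {0..2*pi} (\<lambda>\<theta>. (cmod (f \<theta>))\<^sup>2)"
    by (intro continuous_intros continuous_on_subset[OF c]) auto
  then have "set_integrable lborel {0..2*pi} (\<lambda>\<theta>. (cmod (f \<theta>))\<^sup>2)"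
    by (rule borel_integrable_atLeastAtMost')
  then show ?thesis
    using assms c by (auto simp: circle_C_def circle_L2_def intro: borel_measurable_continuous_onI)
qed

text \<open>The product is dominated by the sum of the two squares, so the inner product is a genuine integral.\<close>

lemma circle_L2_mult_integrable:
  assumes "f \<in> circle_L2" "g \<in> circle_L2"
  shows "set_integrable lborel {0..2*pi} (\<lambda>\<theta>. f \<theta> * cnj (g \<theta>))"
proof (rule set_integrable_bound)
  show "set_integrable lborel {0..2*pi} (\<lambda>\<theta>. (cmod (f \<theta>))\<^sup>2 + (cmod (g \<theta>))\<^sup>2)"
    using assms by (auto simp: circle_L2_def)
  have [measurable]: "f \<in> borel_measurable borel" "g \<in> borel_measurable borel"
    using assms by (auto simp: circle_L2_def)
  have "(\<lambda>\<theta>. cnj (g \<theta>)) \<in> borel_measurable borel"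
    by (rule measurable_compose[OF _ borel_measurable_continuous_onI]) (auto intro: continuous_intros)
  then show "set_borel_measurable lborel {0..2*pi} (\<lambda>\<theta>. f \<theta> * cnj (g \<theta>))"
    unfolding set_borel_measurable_def by measurable
  have "a * b \<le> a\<^sup>2 + b\<^sup>2" if "a \<ge> 0" "b \<ge> 0" for a b :: real
    using sum_squares_bound[of a b] mult_nonneg_nonneg[OF that] by linarith
  then show "AE x in lborel. x \<in> {0..2*pi} \<longrightarrow>
      norm (f x * cnj (g x)) \<le> norm ((cmod (f x))\<^sup>2 + (cmod (g x))\<^sup>2)"
    by (auto simp: norm_mult)
qed

lemma circle_inner_cnj: "circle_inner g f = cnj (circle_inner f g)"
proof -
  have "set_lebesgue_integral lborel {0..2*pi} (\<lambda>\<theta>. g \<theta> * cnj (f \<theta>)) =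
     cnj (set_lebesgue_integral lborel {0..2*pi} (\<lambda>\<theta>. f \<theta> * cnj (g \<theta>)))"
    unfolding set_lebesgue_integral_def
    by (subst Bochner_Integration.integral_cnj[symmetric]) (simp add: mult.commute)
  then show ?thesis by (simp add: circle_inner_def)
qed

lemma circle_inner_self: "circle_inner f f = of_real (circle_sq f)"
  unfolding circle_inner_def circle_sq_def complex_norm_square[symmetric]
  by (simp add: set_integral_complex_of_real flip: of_real_power)

lemma circle_sq_nonneg: "circle_sq f \<ge> 0"
  unfolding circle_sq_def set_lebesgue_integral_def
  by (intro mult_nonneg_nonneg Bochner_Integration.integral_nonneg) (auto simp: indicator_def)

lemma circle_inner_diff_left:
  assumes "f \<in> circle_L2" "g \<in> circle_L2" "h \<in> circle_L2"
  shows "circle_inner (\<lambda>\<theta>. f \<theta> - g \<theta>) h = circle_inner f h - circle_inner g h"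
  using circle_L2_mult_integrable[OF assms(1,3)] circle_L2_mult_integrable[OF assms(2,3)]
  by (simp add: circle_inner_def algebra_simps add_divide_distrib diff_divide_distrib)

lemma circle_inner_diff_right:
  assumes "f \<in> circle_L2" "g \<in> circle_L2" "h \<in> circle_L2"
  shows "circle_inner h (\<lambda>\<theta>. f \<theta> - g \<theta>) = circle_inner h f - circle_inner h g"
  using circle_inner_diff_left[OF assms]
  by (metis circle_inner_cnj complex_cnj_diff)

lemma circle_inner_scale_left: "circle_inner (\<lambda>\<theta>. c * f \<theta>) h = c * circle_inner f h"
  by (simp add: circle_inner_def mult.assoc)

lemma circle_inner_sum_left:
  assumes "finite I" "\<And>i. i \<in> I \<Longrightarrow> f i \<in> circle_C" "h \<in> circle_L2"
  shows "circle_inner (\<lambda>\<theta>. \<Sum>i\<in>I. c i * f i \<theta>) h = (\<Sum>i\<in>I. c i * circle_inner (f i) h)"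
proof -
  have "set_integrable lborel {0..2*pi} (\<lambda>\<theta>. f i \<theta> * cnj (h \<theta>))" if "i \<in> I" for i
    using assms that by (auto intro: circle_L2_mult_integrable circle_C_L2)
  then have *: "set_integrable lborel {0..2*pi} (\<lambda>\<theta>. c i * (f i \<theta> * cnj (h \<theta>)))" if "i \<in> I" for i
    using that by auto
  have "set_lebesgue_integral lborel {0..2*pi} (\<lambda>\<theta>. (\<Sum>i\<in>I. c i * f i \<theta>) * cnj (h \<theta>))
     = set_lebesgue_integral lborel {0..2*pi} (\<lambda>\<theta>. (\<Sum>i\<in>I. c i * (f i \<theta> * cnj (h \<theta>))))"
    by (simp add: sum_distrib_right mult.assoc)
  also have "\<dots> = (\<Sum>i\<in>I. set_lebesgue_integral lborel {0..2*pi} (\<lambda>\<theta>. c i * (f i \<theta> * cnj (h \<theta>))))"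
    using * unfolding set_lebesgue_integral_def set_integrable_def
    by (simp add: scaleR_sum_right)
  finally show ?thesis
    by (simp add: circle_inner_def sum_distrib_left mult.assoc mult.left_commute)
qed

text \<open>A form of the Cauchy-Schwarz inequality, obtained by integrating
  \<open>a b \<le> (\<delta> a\<^sup>2 + b\<^sup>2 / \<delta>) / 2\<close>. A suitable \<open>\<delta>\<close> makes it as good as the inequality with square roots.\<close>

lemma circle_inner_bound:
  assumes "f \<in> circle_L2" "g \<in> circle_L2" "\<delta> > 0"
  shows "cmod (circle_inner f g) \<le> (\<delta> * circle_sq f + circle_sq g / \<delta>) / 2"
proof -
  have "cmod (circle_inner f g) = 1 / (2*pi) * cmod (set_lebesgue_integral lborel {0..2 * pi} (\<lambda>\<theta>. f \<theta> * cnj (g \<theta>)))"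
    by (simp add: circle_inner_def norm_mult norm_divide)
  also have "\<dots> \<le> 1 / (2*pi) * set_lebesgue_integral lborel {0..2 * pi} (\<lambda>\<theta>. cmod (f \<theta> * cnj (g \<theta>)))"
    by (intro mult_left_mono set_integral_norm_bound circle_L2_mult_integrable assms) auto
  also have "\<dots> \<le> 1 / (2*pi) * set_lebesgue_integral lborel {0..2 * pi}
      (\<lambda>\<theta>. \<delta> / 2 * (cmod (f \<theta>))\<^sup>2 + (1 / (2 * \<delta>)) * (cmod (g \<theta>))\<^sup>2)"
  proof (intro mult_left_mono set_integral_mono)
    show "set_integrable lborel {0..2*pi} (\<lambda>\<theta>. cmod (f \<theta> * cnj (g \<theta>)))"
      using circle_L2_mult_integrable[OF assms(1,2)] by (rule set_integrable_norm)
    show "set_integrable lborel {0..2*pi} (\<lambda>\<theta>. \<delta> / 2 * (cmod (f \<theta>))\<^sup>2 + (1 / (2 * \<delta>)) * (cmod (g \<theta>))\<^sup>2)"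
      using assms by (intro set_integral_add set_integrable_mult_right) (auto simp: circle_L2_def)
    have "a * b \<le> \<delta> / 2 * a\<^sup>2 + 1 / (2 * \<delta>) * b\<^sup>2" for a b :: real
    proof -
      have "0 \<le> (\<delta> * a - b)\<^sup>2 / (2 * \<delta>)" using assms by simp
      also have "\<dots> = \<delta> / 2 * a\<^sup>2 + 1 / (2 * \<delta>) * b\<^sup>2 - a * b"
        using assms(3) by (simp add: power2_eq_square field_simps)
      finally show ?thesis by simp
    qed
    then show "cmod (f \<theta> * cnj (g \<theta>)) \<le> \<delta> / 2 * (cmod (f \<theta>))\<^sup>2 + (1 / (2 * \<delta>)) * (cmod (g \<theta>))\<^sup>2" for \<theta>
      by (simp add: norm_mult)
  qed auto
  also have "\<dots> = (\<delta> * circle_sq f + circle_sq g / \<delta>) / 2"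
  proof -
    have "set_integrable lborel {0..2*pi} (\<lambda>\<theta>. \<delta> / 2 * (cmod (f \<theta>))\<^sup>2)"
      "set_integrable lborel {0..2*pi} (\<lambda>\<theta>. (1 / (2 * \<delta>)) * (cmod (g \<theta>))\<^sup>2)"
      using assms by (intro set_integrable_mult_right; auto simp: circle_L2_def)+
    then show ?thesis
      unfolding circle_sq_def
      by (subst set_integral_add(2)) (simp_all add: algebra_simps add_divide_distrib)
  qed
  finally show ?thesis .
qed

lemma circle_sq_le_sup_bound:
  assumes "f \<in> circle_L2" "\<And>\<theta>. cmod (f \<theta>) \<le> e"
  shows "circle_sq f \<le> e\<^sup>2"
proof -
  have "set_integrable lborel {0..2*pi} (\<lambda>\<theta>. (cmod (f \<theta>))\<^sup>2)"
    using assms(1) by (simp add: circle_L2_def)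
  moreover have "set_integrable lborel {0..2*pi} (\<lambda>\<theta>::real. e\<^sup>2)"
    by (intro borel_integrable_atLeastAtMost') auto
  ultimately have "circle_sq f \<le> 1 / (2*pi) * set_lebesgue_integral lborel {0..2*pi} (\<lambda>\<theta>. e\<^sup>2)"
    unfolding circle_sq_def
    using assms(2) by (intro mult_left_mono set_integral_mono power_mono) auto
  also have "\<dots> = e\<^sup>2"
    by (subst set_borel_integral_eq_integral(2))
       (auto intro: borel_integrable_atLeastAtMost')
  finally show ?thesis .
qed

lemma fourier_eq_circle_inner: "fourier g n = circle_inner g (harmonic n)"
proof -
  have "exp (- \<i> * of_int n * of_real \<theta>) = cnj (harmonic n \<theta>)" for \<theta>
    by (simp add: harmonic_def cis_cnj) (simp add: cis_conv_exp mult.assoc)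
  then show ?thesis by (simp add: fourier_def circle_inner_def mult.commute)
qed

lemma circle_inner_harmonic:
  "circle_inner (harmonic m) (harmonic n) = (if m = n then 1 else 0)"
proof -
  have *: "harmonic m \<theta> * cnj (harmonic n \<theta>) = harmonic (m - n) \<theta>" for \<theta>
    by (simp add: harmonic_def cis_cnj cis_mult algebra_simps)
  have i: "set_lebesgue_integral lborel {0..2*pi} (harmonic k) = integral {0..2*pi} (harmonic k)" for k
    by (intro set_borel_integral_eq_integral circle_C_integrable circle_C_harmonic)
  have h: "(harmonic k has_integral 0) {0..2*pi}" if "k \<noteq> 0" for k
  proof -
    have "(harmonic k has_integral (harmonic k (2*pi) / (\<i> * of_int k) - harmonic k 0 / (\<i> * of_int k))) {0..2*pi}"
      using that unfolding harmonic_def[abs_def] cis_conv_exp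
      by (intro fundamental_theorem_of_calculus)
         (auto intro!: derivative_eq_intros has_vector_derivative_real_field simp: scaleR_conv_of_real mult.commute)
    moreover have "harmonic k (2*pi) = harmonic k 0"
      using circle_C_harmonic[of k] unfolding circle_C_def by (metis (mono_tags, lifting) add_0 mem_Collect_eq)
    ultimately show ?thesis by simp
  qed
  show ?thesis
  proof (cases "m = n")
    case True
    have "circle_inner (harmonic m) (harmonic n) = 1 / (2*pi) * integral {0..2*pi} (harmonic 0)"
      using True unfolding circle_inner_def * by (simp add: i)
    also have "harmonic 0 = (\<lambda>_. 1)" by (auto simp: harmonic_def)
    finally show ?thesis using True by (simp add: scaleR_conv_of_real)
  next
    case False
    then show ?thesis
      unfolding circle_inner_def * using h[of "m - n"] by (simp add: i integral_unique)
  qed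
qed

lemma fourier_harmonic: "fourier (harmonic m) n = (if m = n then 1 else 0)"
  by (simp add: fourier_eq_circle_inner circle_inner_harmonic)

lemma fourier_sum_C: "fourier_sum g F \<in> circle_C"
  unfolding fourier_sum_def[abs_def]
  by (intro circle_C_sum circle_C_mult circle_C_const circle_C_harmonic)

text \<open>To be applied to an error \<open>g - p\<close>, written as the error of the Fourier sum minus the difference
  between \<open>p\<close> and the Fourier sum.\<close>

lemma circle_sq_pythagoras:
  assumes r: "r \<in> circle_C" and q: "q \<in> circle_C" and o: "circle_inner q r = 0"
  shows "circle_sq (\<lambda>\<theta>. r \<theta> - q \<theta>) = circle_sq r + circle_sq q"
proof -
  note L = circle_C_L2[OF r] circle_C_L2[OF q] circle_C_L2[OF circle_C_diff[OF r q]]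
  have o': "circle_inner r q = 0" using o by (subst circle_inner_cnj) simp
  have "complex_of_real (circle_sq (\<lambda>\<theta>. r \<theta> - q \<theta>)) = of_real (circle_sq r + circle_sq q)"
    unfolding circle_inner_self[symmetric] of_real_add
    using L o o' by (simp add: circle_inner_diff_left circle_inner_diff_right)
  then show ?thesis by (simp only: of_real_eq_iff)
qed

lemma circle_inner_fourier_sum_right:
  assumes "h \<in> circle_L2" "finite F"
  shows "circle_inner h (fourier_sum g F) = (\<Sum>n\<in>F. fourier h n * cnj (fourier g n))"
proof -
  have "circle_inner (fourier_sum g F) h = (\<Sum>n\<in>F. fourier g n * circle_inner (harmonic n) h)"
    unfolding fourier_sum_def[abs_def]
    using assms by (intro circle_inner_sum_left circle_C_harmonic)
  then have "circle_inner h (fourier_sum g F) = cnj (\<Sum>n\<in>F. fourier g n * circle_inner (harmonic n) h)"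
    using circle_inner_cnj[of h] by simp
  also have "\<dots> = (\<Sum>n\<in>F. fourier h n * cnj (fourier g n))"
    by (simp add: fourier_eq_circle_inner circle_inner_cnj[of h] mult.commute)
  finally show ?thesis .
qed

text \<open>The error of the Fourier sum is orthogonal to the span of the harmonics in \<open>F\<close>, and any other
  combination of these harmonics differs from the Fourier sum by an element of that span.\<close>

lemma fourier_sum_best_approximation:
  assumes g: "g \<in> circle_C" and F: "finite F"
  shows "circle_sq (\<lambda>\<theta>. g \<theta> - fourier_sum g F \<theta>)
           \<le> circle_sq (\<lambda>\<theta>. g \<theta> - (\<Sum>n\<in>F. c n * harmonic n \<theta>))"
proof -
  define r where "r = (\<lambda>\<theta>. g \<theta> - fourier_sum g F \<theta>)"
  define q where "q = (\<lambda>\<theta>. \<Sum>n\<in>F. (c n - fourier g n) * harmonic n \<theta>)"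
  have r: "r \<in> circle_C" unfolding r_def by (intro circle_C_diff g fourier_sum_C)
  have q: "q \<in> circle_C" unfolding q_def
    by (intro circle_C_sum circle_C_mult circle_C_const circle_C_harmonic)
  have "circle_inner (harmonic n) r = 0" if "n \<in> F" for n
  proof -
    have "circle_inner (harmonic n) r = cnj (fourier g n) - circle_inner (harmonic n) (fourier_sum g F)"
      unfolding r_def
      by (subst circle_inner_diff_right)
         (auto intro: circle_C_L2 g fourier_sum_C circle_C_harmonic
               simp: fourier_eq_circle_inner circle_inner_cnj[of _ g])
    also have "circle_inner (harmonic n) (fourier_sum g F) = (\<Sum>m\<in>F. if n = m then cnj (fourier g m) else 0)"
      using F unfolding circle_inner_fourier_sum_right[OF circle_C_L2[OF circle_C_harmonic] F]
      by (intro sum.cong) (auto simp: fourier_harmonic)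
    finally show ?thesis using that F by simp
  qed
  then have "circle_inner q r = 0"
    unfolding q_def
    by (subst circle_inner_sum_left) (auto intro: F circle_C_harmonic circle_C_L2 r)
  then have "circle_sq (\<lambda>\<theta>. r \<theta> - q \<theta>) = circle_sq r + circle_sq q"
    by (intro circle_sq_pythagoras r q)
  moreover have "(\<lambda>\<theta>. r \<theta> - q \<theta>) = (\<lambda>\<theta>. g \<theta> - (\<Sum>n\<in>F. c n * harmonic n \<theta>))"
    by (simp add: r_def q_def fourier_sum_def algebra_simps sum_subtractf fun_eq_iff)
  ultimately show ?thesis
    using circle_sq_nonneg[of q] by (simp add: r_def)
qed

section \<open>Density of trigonometric polynomials and Parseval's identity\<close>

inductive trig_poly :: "(real \<Rightarrow> complex) \<Rightarrow> bool" where
  zero: "trig_poly (\<lambda>_. 0)"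
| add_term: "trig_poly p \<Longrightarrow> trig_poly (\<lambda>\<theta>. p \<theta> + c * harmonic n \<theta>)"

lemma trig_poly_add:
  assumes "trig_poly p" "trig_poly q"
  shows "trig_poly (\<lambda>\<theta>. p \<theta> + q \<theta>)"
  using assms(2)
proof (induction rule: trig_poly.induct)
  case zero
  then show ?case using assms(1) by simp
next
  case (add_term q c n)
  then show ?case using trig_poly.add_term[OF add_term.IH, of c n] by (simp add: add.assoc)
qed

lemma trig_poly_mult_term: "trig_poly p \<Longrightarrow> trig_poly (\<lambda>\<theta>. p \<theta> * (c * harmonic n \<theta>))"
proof (induction rule: trig_poly.induct)
  case zero
  then show ?case using trig_poly.zero by simp
next
  case (add_term p d m)
  have "harmonic (m + n) \<theta> = harmonic m \<theta> * harmonic n \<theta>" for \<theta>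
    by (simp add: harmonic_def cis_mult algebra_simps)
  then show ?case
    using trig_poly.add_term[OF add_term.IH, of "d * c" "m + n"] by (simp add: algebra_simps)
qed

lemma trig_poly_mult:
  assumes "trig_poly p" "trig_poly q"
  shows "trig_poly (\<lambda>\<theta>. p \<theta> * q \<theta>)"
  using assms(2)
proof (induction rule: trig_poly.induct)
  case zero
  then show ?case using trig_poly.zero by simp
next
  case (add_term q c n)
  then show ?case
    using trig_poly_add[OF add_term.IH trig_poly_mult_term[OF assms(1), of c n]]
    by (simp add: algebra_simps)
qed

lemma trig_poly_term: "trig_poly (\<lambda>\<theta>. c * harmonic n \<theta>)"
  using trig_poly.add_term[OF trig_poly.zero, of c n] by simp

lemma trig_poly_const: "trig_poly (\<lambda>_. c)"
  using trig_poly_term[of c 0] by (simp add: harmonic_def)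

text \<open>The coefficients vanish outside \<open>S\<close>, so one family \<open>c\<close> serves all large \<open>F\<close>. This uniformity
  is what a limit along finite sets of frequencies requires.\<close>

lemma trig_poly_expansion:
  assumes "trig_poly p"
  shows "\<exists>c S. finite S \<and> (\<forall>F. finite F \<longrightarrow> S \<subseteq> F \<longrightarrow> p = (\<lambda>\<theta>. \<Sum>n\<in>F. c n * harmonic n \<theta>))"
  using assms
proof (induction rule: trig_poly.induct)
  case zero
  then show ?case by (intro exI[of _ "\<lambda>_. 0"] exI[of _ "{}"]) auto
next
  case (add_term p d m)
  then obtain c S where S: "finite S"
    and c: "\<And>F. finite F \<Longrightarrow> S \<subseteq> F \<Longrightarrow> p = (\<lambda>\<theta>. \<Sum>n\<in>F. c n * harmonic n \<theta>)"
    by blast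
  have "(\<lambda>\<theta>. p \<theta> + d * harmonic m \<theta>)
      = (\<lambda>\<theta>. \<Sum>n\<in>F. (c n + (if n = m then d else 0)) * harmonic n \<theta>)"
    if "finite F" "insert m S \<subseteq> F" for F
  proof
    fix \<theta>
    have "p \<theta> = (\<Sum>n\<in>F. c n * harmonic n \<theta>)"
      using c[of F] that by (simp add: fun_eq_iff)
    moreover have "(\<Sum>n\<in>F. (if n = m then d else 0) * harmonic n \<theta>) = d * harmonic m \<theta>"
      using that by (simp add: if_distrib[of "\<lambda>x. x * _"] cong: if_cong)
    ultimately show "p \<theta> + d * harmonic m \<theta> = (\<Sum>n\<in>F. (c n + (if n = m then d else 0)) * harmonic n \<theta>)"
      by (simp add: distrib_right sum.distrib)
  qed
  then show ?case using S by (intro exI[of _ "\<lambda>n. c n + (if n = m then d else 0)"] exI[of _ "insert m S"]) auto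
qed

text \<open>A real-linear function of \<open>z = e\<^sup>i\<^sup>\<theta>\<close> is a combination of \<open>z\<close> and its conjugate, that is, of the
  harmonics \<open>1\<close> and \<open>-1\<close>; sums and products then stay among the trigonometric polynomials.\<close>

lemma trig_poly_real_polynomial:
  fixes p :: "complex \<Rightarrow> real"
  assumes "real_polynomial_function p"
  shows "trig_poly (\<lambda>\<theta>. of_real (p (cis \<theta>)))"
  using assms
proof (induction rule: real_polynomial_function.induct)
  case (linear f)
  interpret f: bounded_linear f by fact
  have "complex_of_real (f (cis \<theta>)) =
     (of_real (f 1) - \<i> * of_real (f \<i>)) / 2 * harmonic 1 \<theta> +
     (of_real (f 1) + \<i> * of_real (f \<i>)) / 2 * harmonic (-1) \<theta>" for \<theta>
  proof -
    have "cis \<theta> = cos \<theta> *\<^sub>R 1 + sin \<theta> *\<^sub>R \<i>" by (simp add: complex_eq_iff)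
    then have "f (cis \<theta>) = cos \<theta> * f 1 + sin \<theta> * f \<i>"
      by (simp only: f.add f.scaleR real_scaleR_def)
    then show ?thesis by (simp add: harmonic_def complex_eq_iff field_simps)
  qed
  then show ?case
    using trig_poly_add[OF trig_poly_term[of "(of_real (f 1) - \<i> * of_real (f \<i>)) / 2" 1]
        trig_poly_term[of "(of_real (f 1) + \<i> * of_real (f \<i>)) / 2" "-1"]] by simp
next
  case (const c)
  show ?case by (rule trig_poly_const)
next
  case (add f g)
  then show ?case using trig_poly_add by fastforce
next
  case (mult f g)
  then show ?case using trig_poly_mult by fastforce
qed

lemma circle_C_periodic:
  assumes "g \<in> circle_C"
  shows "g (\<theta> + 2 * pi * of_int n) = g \<theta>"
proof -
  have per: "g (\<theta> + 2 * pi) = g \<theta>" for \<theta> using assms by (simp add: circle_C_def)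
  have pern: "g (\<theta> + 2 * pi * of_nat n) = g \<theta>" for \<theta> n
  proof (induction n)
    case (Suc n)
    have "\<theta> + 2 * pi * of_nat (Suc n) = (\<theta> + 2 * pi * of_nat n) + 2 * pi"
      by (simp add: algebra_simps)
    then show ?case using Suc per by metis
  qed simp
  show ?thesis
  proof (cases "n \<ge> 0")
    case True
    then show ?thesis using pern[of \<theta> "nat n"] by simp
  next
    case False
    then show ?thesis using pern[of "\<theta> + 2 * pi * of_int n" "nat (-n)"] by simp
  qed
qed

text \<open>A periodic function descends to the unit circle. The argument jumps on the negative real axis, but
  there \<open>Arg (- z) + pi\<close> is continuous and differs from \<open>Arg z\<close> by a period.\<close>

lemma circle_C_Arg:
  assumes g: "g \<in> circle_C"
  shows "continuous_on (sphere 0 1) (\<lambda>z. g (Arg z))" and "g (Arg (cis \<theta>)) = g \<theta>"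
proof -
  have per: "g (\<theta> + 2 * pi) = g \<theta>" for \<theta> using g by (simp add: circle_C_def)
  have gc: "isCont g \<theta>" for \<theta>
  proof -
    have "continuous_on UNIV g" using g by (simp add: circle_C_def)
    then show ?thesis by (simp only: continuous_on_eq_continuous_at[OF open_UNIV]) simp
  qed
  have "isCont (\<lambda>z. g (Arg z)) z" if "z \<noteq> 0" for z
  proof (cases "z \<in> \<real>\<^sub>\<le>\<^sub>0")
    case False
    show ?thesis
      using continuous_at_Arg[OF False] gc by (rule isCont_o2)
  next
    case True
    have "- z \<notin> \<real>\<^sub>\<le>\<^sub>0"
      using True that by (auto simp: complex_nonpos_Reals_iff complex_eq_iff)
    then have "isCont (\<lambda>z. Arg (- z)) z"
      by (intro isCont_o2[where f = uminus and g = Arg] continuous_at_Arg) (auto intro: continuous_intros)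
    then have "isCont (\<lambda>z. Arg (- z) + pi) z"
      by (intro continuous_add continuous_const)
    then have "isCont (\<lambda>z. g (Arg (- z) + pi)) z"
      using gc by (rule isCont_o2)
    moreover have "\<forall>\<^sub>F w in nhds z. g (Arg (- w) + pi) = g (Arg w)"
    proof -
      have "\<forall>\<^sub>F w in nhds z. w \<noteq> 0"
        using that by (rule t1_space_nhds)
      then show ?thesis
      proof eventually_elim
        case (elim w)
        then show ?case using per[of "Arg w"] by (auto simp: Arg_minus add.assoc)
      qed
    qed
    ultimately show ?thesis 
      using isCont_cong[of "\<lambda>w. g (Arg (- w) + pi)" "\<lambda>w. g (Arg w)" z] by simp
  qed
  then show "continuous_on (sphere 0 1) (\<lambda>z. g (Arg z))"
    by (intro continuous_at_imp_continuous_on) (metis mem_sphere_0 norm_zero zero_neq_one)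
  show "g (Arg (cis \<theta>)) = g \<theta>"
  proof -
    have "cis (Arg (cis \<theta>)) = cis \<theta>"
      using Arg_eq[of "cis \<theta>"] by (simp add: cis_conv_exp)
    then obtain n :: int where
      "\<i> * complex_of_real (Arg (cis \<theta>)) = \<i> * complex_of_real \<theta> + of_int (2 * n) * (of_real pi * \<i>)"
      unfolding cis_conv_exp exp_eq by (auto simp: mult.assoc)
    then have n: "Arg (cis \<theta>) = \<theta> + 2 * pi * of_int n"
      by (simp add: complex_eq_iff)
    then show ?thesis using circle_C_periodic[OF g, of \<theta> n] by simp
  qed
qed

lemma circle_C_trig_poly_dense:
  assumes g: "g \<in> circle_C" and e: "e > 0"
  obtains p where "trig_poly p" "\<And>\<theta>. cmod (g \<theta> - p \<theta>) < e"
proof -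
  obtain P where P: "polynomial_function P"
      and le: "\<And>z. z \<in> sphere 0 1 \<Longrightarrow> cmod (g (Arg z) - P z) < e"
    using Stone_Weierstrass_polynomial_function[OF compact_sphere circle_C_Arg(1)[OF g] e] by blast
  have "real_polynomial_function (Re \<circ> P)" "real_polynomial_function (Im \<circ> P)"
    using P bounded_linear_Re bounded_linear_Im unfolding polynomial_function_def by blast+
  note * = this[THEN trig_poly_real_polynomial]
  have "trig_poly (\<lambda>\<theta>. complex_of_real (Re (P (cis \<theta>))) + \<i> * complex_of_real (Im (P (cis \<theta>))))"
    using trig_poly_add[OF *(1) trig_poly_mult[OF trig_poly_const[of \<i>] *(2)]] by simp
  then have "trig_poly (\<lambda>\<theta>. P (cis \<theta>))"
    by (simp flip: complex_eq)
  moreover have "cmod (g \<theta> - P (cis \<theta>)) < e" for \<theta>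
    using le[of "cis \<theta>"] by (simp add: circle_C_Arg(2)[OF g])
  ultimately show ?thesis by (rule that)
qed

text \<open>For finite \<open>F\<close> the error is the inner product of \<open>h\<close> with \<open>g\<close> minus its Fourier sum. As soon as
  \<open>F\<close> contains the frequencies of a trigonometric polynomial close to \<open>g\<close>, the best approximation
  property makes this remainder small. The function \<open>h\<close> ranges over all of
  \<open>L\<^sup>2\<close> because the definition of the adjoint tests against all of it.\<close>

lemma parseval:
  assumes h: "h \<in> circle_L2" and g: "g \<in> circle_C"
  shows "((\<lambda>n. fourier h n * cnj (fourier g n)) has_sum circle_inner h g) UNIV"
  unfolding has_sum_def
proof (rule tendstoI)
  fix e :: real assume e: "e > 0"
  define A where "A = circle_sq h + 1"
  have A: "A > 0" using circle_sq_nonneg[of h] by (simp add: A_def)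
  \<comment> \<open>With this \<open>d\<close>, a uniform distance \<open>d\<close> leaves a remainder of at most \<open>d A / 2 = e / 2\<close>.\<close>
  define d where "d = e / A"
  have d: "d > 0" using e A by (simp add: d_def)
  obtain p where p: "trig_poly p" and le: "\<And>\<theta>. cmod (g \<theta> - p \<theta>) < d"
    using circle_C_trig_poly_dense[OF g d] by blast
  obtain c S where S: "finite S"
    and c: "\<And>F. finite F \<Longrightarrow> S \<subseteq> F \<Longrightarrow> p = (\<lambda>\<theta>. \<Sum>n\<in>F. c n * harmonic n \<theta>)"
    using trig_poly_expansion[OF p] by blast
  have "dist (\<Sum>n\<in>F. fourier h n * cnj (fourier g n)) (circle_inner h g) < e"
    if F: "finite F" "S \<subseteq> F" for F
  proof -
    define r where "r = (\<lambda>\<theta>. g \<theta> - fourier_sum g F \<theta>)"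
    have r: "r \<in> circle_C" unfolding r_def by (intro circle_C_diff g fourier_sum_C)
    have "(\<lambda>\<theta>. g \<theta> - p \<theta>) \<in> circle_C"
      unfolding c[OF F]
      by (intro circle_C_diff g circle_C_sum circle_C_mult circle_C_const circle_C_harmonic)
    then have "circle_sq (\<lambda>\<theta>. g \<theta> - p \<theta>) \<le> d\<^sup>2"
      by (intro circle_sq_le_sup_bound circle_C_L2) (use le less_imp_le in auto)
    then have "circle_sq r \<le> d\<^sup>2"
      using fourier_sum_best_approximation[OF g F(1), of c] c[OF F] unfolding r_def by simp
    have "cmod (circle_inner h r) \<le> (d * circle_sq h + circle_sq r / d) / 2"
      by (intro circle_inner_bound h circle_C_L2 r d)
    also have "\<dots> \<le> (d * circle_sq h + d\<^sup>2 / d) / 2"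
      using d \<open>circle_sq r \<le> d\<^sup>2\<close> by (intro divide_right_mono add_left_mono) auto
    also have "\<dots> = d * A / 2"
      using d by (simp add: A_def power2_eq_square algebra_simps)
    also have "\<dots> = e / 2"
      using A by (simp add: d_def)
    also have "\<dots> < e" using e by simp
    finally have "cmod (circle_inner h r) < e" .
    moreover have "circle_inner h r = circle_inner h g - (\<Sum>n\<in>F. fourier h n * cnj (fourier g n))"
      unfolding r_def
      by (simp add: circle_inner_diff_right h g circle_C_L2 fourier_sum_C circle_inner_fourier_sum_right F)
    ultimately show ?thesis by (simp add: dist_norm norm_minus_commute)
  qed
  then show "\<forall>\<^sub>F F in finite_subsets_at_top UNIV.
      dist (\<Sum>n\<in>F. fourier h n * cnj (fourier g n)) (circle_inner h g) < e"
    unfolding eventually_finite_subsets_at_top using S by blast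
qed

lemma parseval_sq:
  assumes "g \<in> circle_C"
  shows "((\<lambda>n. (cmod (fourier g n))\<^sup>2) has_sum circle_sq g) UNIV"
proof -
  have "((\<lambda>n. complex_of_real ((cmod (fourier g n))\<^sup>2)) has_sum of_real (circle_sq g)) UNIV"
    using parseval[OF circle_C_L2[OF assms] assms]
    by (simp only: circle_inner_self complex_norm_square)
  then show ?thesis by (simp only: has_sum_of_real_iff)
qed

section \<open>The walk and its characteristic function\<close>

text \<open>The range is the image of the compact unit circle.\<close>

lemma circle_C_bounded:
  assumes g: "g \<in> circle_C"
  obtains B where "B \<ge> 0" "\<And>\<theta>. cmod (g \<theta>) \<le> B"
proof -
  have "compact ((\<lambda>z. g (Arg z)) ` sphere 0 1)"
    by (intro compact_continuous_image circle_C_Arg(1)[OF g] compact_sphere)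
  then obtain B where B: "\<And>z. z \<in> sphere 0 1 \<Longrightarrow> cmod (g (Arg z)) \<le> B"
    using compact_imp_bounded bounded_iff by (metis imageI)
  have "cmod (g \<theta>) \<le> \<bar>B\<bar>" for \<theta>
    using B[of "cis \<theta>"] circle_C_Arg(2)[OF g, of \<theta>] by simp
  then show ?thesis using that[of "\<bar>B\<bar>"] by simp
qed

lemma circle_C_shift: "g \<in> circle_C \<Longrightarrow> (\<lambda>\<theta>. g (\<theta> + \<eta>)) \<in> circle_C"
  unfolding circle_C_def
  by (auto intro!: continuous_on_compose2[of UNIV g] continuous_intros)
     (metis add.assoc add.commute)

lemma circle_C_integral_shift:
  assumes g: "g \<in> circle_C"
  shows "integral {0..2*pi} (\<lambda>\<theta>. g (\<theta> + \<eta>)) = integral {0..2*pi} g"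
proof -
  have int: "g integrable_on {a..b}" for a b
    using g by (intro integrable_continuous_real) (auto simp: circle_C_def intro: continuous_on_subset)
  have shift: "integral {a..b} (\<lambda>\<theta>. g (\<theta> + c)) = integral {a+c..b+c} g" for a b c
    using integral_shift_Icc_real[of a b g c] by (simp add: o_def add.commute)
  \<comment> \<open>By periodicity the shift may be reduced to one in \<open>[0, 2 pi]\<close>.\<close>
  define n where "n = \<lfloor>\<eta> / (2*pi)\<rfloor>"
  define \<eta>' where "\<eta>' = \<eta> - 2 * pi * of_int n"
  have "of_int n \<le> \<eta> / (2*pi)" "\<eta> / (2*pi) \<le> of_int n + 1"
    unfolding n_def by linarith+
  then have \<eta>': "0 \<le> \<eta>'" "\<eta>' \<le> 2 * pi"
    unfolding \<eta>'_def by (auto simp: field_simps)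
  have "g (\<theta> + \<eta>) = g (\<theta> + \<eta>')" for \<theta>
    using circle_C_periodic[OF g, of "\<theta> + \<eta>'" n] by (simp add: \<eta>'_def)
  then have "integral {0..2*pi} (\<lambda>\<theta>. g (\<theta> + \<eta>)) = integral {\<eta>'..2*pi+\<eta>'} g"
    using shift[of 0 "2*pi" \<eta>'] by simp
  also have "\<dots> = integral {\<eta>'..2*pi} g + integral {2*pi..2*pi+\<eta>'} g"
    using \<eta>' by (intro Henstock_Kurzweil_Integration.integral_combine[symmetric] int) auto
  also have "integral {2*pi..2*pi+\<eta>'} g = integral {0..\<eta>'} (\<lambda>\<theta>. g (\<theta> + 2*pi))"
    using shift[of 0 \<eta>' "2*pi"] by (simp add: add.commute)
  also have "(\<lambda>\<theta>. g (\<theta> + 2*pi)) = g"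
    using g by (simp add: circle_C_def)
  also have "integral {\<eta>'..2*pi} g + integral {0..\<eta>'} g = integral {0..2*pi} g"
    using \<eta>' by (subst add.commute, intro Henstock_Kurzweil_Integration.integral_combine int) auto
  finally show ?thesis .
qed

lemma circle_inner_eq_integral:
  assumes "f \<in> circle_C" "g \<in> circle_C"
  shows "circle_inner f g = 1 / (2*pi) * integral {0..2*pi} (\<lambda>\<theta>. f \<theta> * cnj (g \<theta>))"
  unfolding circle_inner_def
  by (subst set_borel_integral_eq_integral(2)) (auto intro: circle_L2_mult_integrable circle_C_L2 assms)

lemma fourier_shift:
  assumes g: "g \<in> circle_C"
  shows "fourier (\<lambda>\<theta>. g (\<theta> + \<eta>)) n = harmonic n \<eta> * fourier g n"
proof -
  have h: "cnj (harmonic n \<theta>) = harmonic (- n) \<theta>" for \<theta>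
    by (simp add: harmonic_def cis_cnj)
  have *: "g (\<theta> + \<eta>) * cnj (harmonic n \<theta>) = harmonic n \<eta> * (g (\<theta> + \<eta>) * cnj (harmonic n (\<theta> + \<eta>)))" for \<theta>
    unfolding h by (simp add: harmonic_def cis_mult algebra_simps)
  have "(\<lambda>\<theta>. g \<theta> * cnj (harmonic n \<theta>)) \<in> circle_C"
    unfolding h by (intro circle_C_mult g circle_C_harmonic)
  from circle_C_integral_shift[OF this, of \<eta>] show ?thesis
    by (simp add: fourier_eq_circle_inner circle_inner_eq_integral g circle_C_shift circle_C_harmonic *)
qed

text \<open>The adjoint returns some representative of \<open>g\<close>. It is characterised here only by its inner
  products, which are all that enters the operator \<open>H_hat\<close>.\<close>

lemma fourier_adj_fourier:
  assumes g: "g \<in> circle_C"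
  shows "fourier_adj (fourier g) \<in> circle_L2"
    and "h \<in> circle_L2 \<Longrightarrow> circle_inner h (fourier_adj (fourier g)) = circle_inner h g"
proof -
  have *: "ell2_inner (fourier h) (fourier g) = circle_inner h g" if "h \<in> circle_L2" for h
    unfolding ell2_inner_def by (intro infsumI parseval that g)
  then have "fourier_adj (fourier g) \<in> circle_L2 \<and>
      (\<forall>h\<in>circle_L2. ell2_inner (fourier h) (fourier g) = circle_inner h (fourier_adj (fourier g)))"
    unfolding fourier_adj_def
    by (intro someI[of "\<lambda>a. a \<in> circle_L2 \<and> (\<forall>h\<in>circle_L2. ell2_inner (fourier h) (fourier g) = circle_inner h a)" g])
       (auto intro: circle_C_L2 g)
  then show "fourier_adj (fourier g) \<in> circle_L2"
    and "h \<in> circle_L2 \<Longrightarrow> circle_inner h (fourier_adj (fourier g)) = circle_inner h g"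
    using * by auto
qed

text \<open>On Fourier transforms of continuous functions, \<open>H_hat k\<close> is multiplication by \<open>k\<close>. Each Fourier
  coefficient of \<open>k\<close> times a function is an inner product of that function with \<open>k\<close> times a
  harmonic, so the weak description of the adjoint suffices.\<close>

lemma H_hat_fourier:
  assumes g: "g \<in> circle_C" and k: "(\<lambda>\<theta>. complex_of_real (k \<theta>)) \<in> circle_C"
  shows "H_hat k (fourier g) = fourier (\<lambda>\<theta>. of_real (k \<theta>) * g \<theta>)"
proof
  fix n
  \<comment> \<open>Since \<open>k\<close> is real, multiplication by it moves to the other side of the inner product.\<close>
  have move: "fourier (\<lambda>\<theta>. of_real (k \<theta>) * G \<theta>) n = cnj (circle_inner (\<lambda>\<theta>. of_real (k \<theta>) * harmonic n \<theta>) G)" for G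
    unfolding circle_inner_cnj[of G, symmetric] fourier_eq_circle_inner
    by (simp add: circle_inner_def mult.commute mult.left_commute)
  have "(\<lambda>\<theta>. of_real (k \<theta>) * harmonic n \<theta>) \<in> circle_L2"
    by (intro circle_C_L2 circle_C_mult k circle_C_harmonic)
  then have "fourier (\<lambda>\<theta>. of_real (k \<theta>) * fourier_adj (fourier g) \<theta>) n = fourier (\<lambda>\<theta>. of_real (k \<theta>) * g \<theta>) n"
    unfolding move by (simp add: fourier_adj_fourier(2)[OF g])
  then show "H_hat k (fourier g) n = fourier (\<lambda>\<theta>. of_real (k \<theta>) * g \<theta>) n"
    by (simp add: H_hat_def mult_op_def[abs_def])
qed

lemma fourier_sum_linear:
  assumes "finite I" "\<And>i. i \<in> I \<Longrightarrow> f i \<in> circle_C"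
  shows "fourier (\<lambda>\<theta>. \<Sum>i\<in>I. c i * f i \<theta>) n = (\<Sum>i\<in>I. c i * fourier (f i) n)"
  unfolding fourier_eq_circle_inner
  by (rule circle_inner_sum_left) (auto intro: assms circle_C_L2 circle_C_harmonic)

lemma ell2_norm_fourier:
  assumes "g \<in> circle_C"
  shows "fourier g \<in> ell2" "ell2_norm (fourier g) = sqrt (circle_sq g)"
  using parseval_sq[OF assms] by (auto simp: ell2_def ell2_norm_def summable_on_def infsumI)

lemma ell2_diff:
  assumes "v \<in> ell2" "w \<in> ell2"
  shows "(\<lambda>x. v x - w x) \<in> ell2"
  unfolding ell2_def mem_Collect_eq
proof (rule summable_on_comparison_test)
  show "(\<lambda>x. 2 * (cmod (v x))\<^sup>2 + 2 * (cmod (w x))\<^sup>2) summable_on UNIV"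
    using assms by (intro summable_on_add summable_on_cmult_right) (auto simp: ell2_def)
  fix x
  have "(cmod (v x - w x))\<^sup>2 \<le> (cmod (v x) + cmod (w x))\<^sup>2"
    by (intro power_mono norm_triangle_ineq4) auto
  also have "\<dots> \<le> 2 * (cmod (v x))\<^sup>2 + 2 * (cmod (w x))\<^sup>2"
    using sum_squares_bound[of "cmod (v x)" "cmod (w x)"] by (simp add: power2_sum)
  finally show "(cmod (v x - w x))\<^sup>2 \<le> 2 * (cmod (v x))\<^sup>2 + 2 * (cmod (w x))\<^sup>2" .
qed auto

lemma ell2_tendsto_pointwise:
  assumes "ell2_tendsto S w"
  shows "(\<lambda>N. S N x) \<longlonglongrightarrow> w x"
proof -
  have "cmod (S N x - w x) \<le> ell2_norm (\<lambda>x. S N x - w x)" for N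
  proof -
    have "(\<lambda>x. S N x - w x) \<in> ell2"
      using assms by (intro ell2_diff) (auto simp: ell2_tendsto_def)
    then have "(\<Sum>x\<in>{x}. (cmod (S N x - w x))\<^sup>2) \<le> (\<Sum>\<^sub>\<infinity>x. (cmod (S N x - w x))\<^sup>2)"
      by (intro finite_sum_le_infsum) (auto simp: ell2_def)
    then show ?thesis unfolding ell2_norm_def by (intro real_le_rsqrt) simp
  qed
  moreover have "(\<lambda>N. ell2_norm (\<lambda>x. S N x - w x)) \<longlonglongrightarrow> 0"
    using assms by (simp add: ell2_tendsto_def)
  ultimately have "(\<lambda>N. S N x - w x) \<longlonglongrightarrow> 0"
    by (intro Lim_null_comparison[of "\<lambda>N. S N x - w x"] always_eventually) auto
  then show ?thesis by (simp add: LIM_zero_iff)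
qed

text \<open>The \<open>n\<close>-th term of the exponential series is the transform of \<open>(i t k)\<^sup>n / n!\<close>. On the circle the
  partial sums converge uniformly because \<open>k\<close> is bounded, and by Parseval's identity the transform
  turns this into convergence in \<open>\<ell>\<^sup>2\<close>. Limits in \<open>\<ell>\<^sup>2\<close> are pointwise limits and hence unique.\<close>

lemma exp_op_fourier:
  assumes k: "(\<lambda>\<theta>. complex_of_real (k \<theta>)) \<in> circle_C"
  shows "exp_op (\<lambda>v y. \<i> * of_real t * H_hat k v y) (ell2_delta 0)
       = fourier (\<lambda>\<theta>. exp (\<i> * of_real (t * k \<theta>)))"
proof -
  define z where "z = (\<lambda>\<theta>. \<i> * complex_of_real (t * k \<theta>))"
  define A where "A = (\<lambda>v y. \<i> * of_real t * H_hat k v y)"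
  define S where "S = (\<lambda>N x. \<Sum>n<N. (A ^^ n) (ell2_delta 0) x / fact n)"
  define p where "p = (\<lambda>N \<theta>. \<Sum>n<N. (1 / fact n) * z \<theta> ^ n)"
  have z: "z \<in> circle_C"
    using circle_C_mult[OF circle_C_const[of "\<i> * of_real t"] k] by (simp add: z_def mult.assoc)
  have zn: "(\<lambda>\<theta>. z \<theta> ^ n) \<in> circle_C" for n
    by (induction n) (auto intro: circle_C_mult circle_C_const z)
  have ez: "(\<lambda>\<theta>. exp (z \<theta>)) \<in> circle_C"
    using z by (auto simp: circle_C_def intro: continuous_intros)
  have p: "p N \<in> circle_C" for N
    unfolding p_def by (intro circle_C_sum circle_C_mult circle_C_const zn)
  have "(A ^^ n) (ell2_delta 0) = fourier (\<lambda>\<theta>. z \<theta> ^ n)" for n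
  proof (induction n)
    case 0
    \<comment> \<open>The walk starts at the site \<open>0\<close>, which is the constant function \<open>1\<close> on the circle.\<close>
    have "harmonic 0 = (\<lambda>_. 1)" by (auto simp: harmonic_def)
    then have "fourier (\<lambda>_. 1) x = (if 0 = x then 1 else 0)" for x
      using fourier_harmonic[of 0 x] by simp
    then show ?case by (auto simp: ell2_delta_def fun_eq_iff)
  next
    case (Suc n)
    have "fourier (\<lambda>\<theta>. z \<theta> ^ Suc n) y = \<i> * of_real t * fourier (\<lambda>\<theta>. of_real (k \<theta>) * z \<theta> ^ n) y" for y
      unfolding fourier_eq_circle_inner circle_inner_scale_left[symmetric]
      by (simp add: z_def mult.assoc mult.left_commute)
    moreover have "(A ^^ Suc n) (ell2_delta 0) = A (fourier (\<lambda>\<theta>. z \<theta> ^ n))"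
      using Suc by simp
    ultimately show ?case unfolding A_def H_hat_fourier[OF zn k] by auto
  qed
  then have S: "S N = fourier (p N)" for N
    unfolding S_def p_def
    using fourier_sum_linear[of "{..<N}" "\<lambda>n \<theta>. z \<theta> ^ n" "\<lambda>n. 1 / fact n" for N, OF _ zn]
    by (simp add: fun_eq_iff)
  have lim: "ell2_tendsto S (fourier (\<lambda>\<theta>. exp (z \<theta>)))"
    unfolding ell2_tendsto_def
  proof (intro conjI allI)
    show "S N \<in> ell2" for N by (simp add: S ell2_norm_fourier p)
    show "fourier (\<lambda>\<theta>. exp (z \<theta>)) \<in> ell2" by (simp add: ell2_norm_fourier ez)
    obtain B where B: "B \<ge> 0" "\<And>\<theta>. cmod (z \<theta>) \<le> B" using circle_C_bounded[OF z] by blast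
    define b where "b = (\<lambda>m. exp B * B * (inverse (fact m) * B ^ m))"
    have bound: "ell2_norm (\<lambda>x. S (Suc m) x - fourier (\<lambda>\<theta>. exp (z \<theta>)) x) \<le> b m" for m
    proof -
      define d where "d = (\<lambda>\<theta>. p (Suc m) \<theta> - exp (z \<theta>))"
      have d: "d \<in> circle_C" unfolding d_def by (intro circle_C_diff p ez)
      have "(\<lambda>x. S (Suc m) x - fourier (\<lambda>\<theta>. exp (z \<theta>)) x) = fourier d"
        unfolding S d_def fourier_eq_circle_inner
        by (simp add: fun_eq_iff circle_inner_diff_left circle_C_L2 p ez circle_C_harmonic)
      then have "ell2_norm (\<lambda>x. S (Suc m) x - fourier (\<lambda>\<theta>. exp (z \<theta>)) x) = sqrt (circle_sq d)"
        by (simp add: ell2_norm_fourier d)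
      also have "cmod (d \<theta>) \<le> b m" for \<theta>
      proof -
        have "p (Suc m) \<theta> = (\<Sum>i\<le>m. z \<theta> ^ i / fact i)"
          by (simp add: p_def lessThan_Suc_atMost)
        then have "cmod (d \<theta>) \<le> exp (cmod (z \<theta>)) * (cmod (z \<theta>) ^ Suc m) / fact m"
          using Taylor_exp_field[of "z \<theta>" m] by (simp add: d_def norm_minus_commute)
        also have "\<dots> \<le> exp B * B ^ Suc m / fact m"
          using B by (intro divide_right_mono mult_mono power_mono) auto
        finally show ?thesis by (simp add: b_def divide_inverse mult.commute mult.left_commute)
      qed
      then have "circle_sq d \<le> (b m)\<^sup>2"
        by (intro circle_sq_le_sup_bound circle_C_L2 d)
      then have "sqrt (circle_sq d) \<le> b m"
        using B by (intro real_le_lsqrt circle_sq_nonneg) (auto simp: b_def)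
      finally show ?thesis .
    qed
    have nonneg: "0 \<le> ell2_norm v" for v
      by (simp add: ell2_norm_def infsum_nonneg)
    have "b \<longlonglongrightarrow> 0"
      unfolding b_def using tendsto_mult_right_zero[OF summable_LIMSEQ_zero[OF summable_exp[of B]]] by simp
    then have "(\<lambda>m. ell2_norm (\<lambda>x. S (Suc m) x - fourier (\<lambda>\<theta>. exp (z \<theta>)) x)) \<longlonglongrightarrow> 0"
      by (rule tendsto_sandwich[OF _ _ tendsto_const, rotated 2])
         (simp_all only: nonneg bound eventually_True)
    then show "(\<lambda>m. ell2_norm (\<lambda>x. S m x - fourier (\<lambda>\<theta>. exp (z \<theta>)) x)) \<longlonglongrightarrow> 0"
      by (subst (asm) filterlim_sequentially_Suc)
  qed
  moreover have "w = fourier (\<lambda>\<theta>. exp (z \<theta>))" if "ell2_tendsto S w" for w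
    using ell2_tendsto_pointwise[OF that] ell2_tendsto_pointwise[OF lim] LIMSEQ_unique by blast
  ultimately have "(THE w. ell2_tendsto S w) = fourier (\<lambda>\<theta>. exp (z \<theta>))"
    by (rule the_equality)
  then show ?thesis
    by (simp add: exp_op_def S_def A_def z_def)
qed

lemma ell2_inner_delta: "ell2_inner v (ell2_delta x) = v x"
  unfolding ell2_inner_def
  by (rule infsumI, rule has_sum_finite_neutralI[of "{x}"]) (auto simp: ell2_delta_def)

lemma walk_prob_eq_fourier:
  assumes k: "(\<lambda>\<theta>. complex_of_real (k \<theta>)) \<in> circle_C"
  shows "walk_prob t k x = (cmod (fourier (\<lambda>\<theta>. exp (\<i> * of_real (t * k \<theta>))) x))\<^sup>2"
  unfolding walk_prob_def exp_op_fourier[OF k] ell2_inner_delta ..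

lemma circle_C_phase:
  assumes k: "(\<lambda>\<theta>. complex_of_real (k \<theta>)) \<in> circle_C"
  shows "(\<lambda>\<theta>. exp (\<i> * of_real (t * k \<theta>))) \<in> circle_C"
  using k unfolding circle_C_def by (auto intro!: continuous_intros)

lemma walk_prob_has_sum:
  assumes k: "(\<lambda>\<theta>. complex_of_real (k \<theta>)) \<in> circle_C"
  shows "(walk_prob t k has_sum 1) UNIV"
proof -
  have "circle_sq (\<lambda>\<theta>. exp (\<i> * of_real (t * k \<theta>))) = 1"
    unfolding circle_sq_def norm_exp_i_times
    by (subst set_borel_integral_eq_integral(2)) (auto intro: borel_integrable_atLeastAtMost')
  then show ?thesis
    using parseval_sq[OF circle_C_phase[OF k, of t]]
    unfolding walk_prob_eq_fourier[OF k, abs_def] by simp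
qed

lemma walk_measure_real_distribution:
  assumes k: "(\<lambda>\<theta>. complex_of_real (k \<theta>)) \<in> circle_C"
  shows "real_distribution (walk_measure t k)"
proof -
  have nonneg: "walk_prob t k x \<ge> 0" for x by (simp add: walk_prob_def)
  have "Infinite_Set_Sum.abs_summable_on (walk_prob t k) UNIV"
    using walk_prob_has_sum[OF k, of t] nonneg
    by (auto simp: abs_summable_equivalent[symmetric] summable_on_def)
  then have "(\<integral>\<^sup>+x. ennreal (walk_prob t k x) \<partial>count_space UNIV) = ennreal 1"
    using walk_prob_has_sum[OF k, of t] nonneg
    by (subst nn_integral_conv_infsetsum) (auto simp: infsetsum_infsum infsumI)
  then have "prob_space (density (count_space UNIV) (\<lambda>x::int. ennreal (walk_prob t k x)))"
    by (intro prob_spaceI) (simp add: emeasure_density)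
  then show ?thesis
    unfolding walk_measure_def by (rule prob_space.real_distribution_distr) auto
qed

text \<open>The weights are \<open>\<bar>g\<^sub>x\<bar>\<^sup>2\<close> for the Fourier coefficients \<open>g\<^sub>x\<close> of \<open>g = exp (i t k)\<close>. Multiplying \<open>g\<^sub>x\<close> by
  \<open>exp (i x \<xi> / t)\<close> translates \<open>g\<close> by \<open>\<xi> / t\<close>, so by Parseval's identity the characteristic
  function is the inner product of this translate with \<open>g\<close>.\<close>

lemma char_walk_measure:
  assumes k: "(\<lambda>\<theta>. complex_of_real (k \<theta>)) \<in> circle_C"
  shows "char (walk_measure t k) \<xi>
       = 1 / (2*pi) * integral {0..2*pi} (\<lambda>\<theta>. exp (\<i> * of_real (t * (k (\<theta> + \<xi> / t) - k \<theta>))))"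
proof -
  define g where "g = (\<lambda>\<theta>. exp (\<i> * of_real (t * k \<theta>)))"
  define \<eta> where "\<eta> = \<xi> / t"
  have g: "g \<in> circle_C" unfolding g_def by (rule circle_C_phase[OF k])
  have nonneg: "walk_prob t k x \<ge> 0" for x by (simp add: walk_prob_def)
  define F where "F = (\<lambda>x::int. walk_prob t k x *\<^sub>R iexp (\<xi> * (of_int x / t)))"
  have F_summable: "Infinite_Set_Sum.abs_summable_on F UNIV"
    using walk_prob_has_sum[OF k, of t] nonneg
    by (auto simp: F_def abs_summable_equivalent[symmetric] summable_on_def)
  have F: "F x = fourier (\<lambda>\<theta>. g (\<theta> + \<eta>)) x * cnj (fourier g x)" for x
  proof -
    have "F x = iexp (\<xi> * (of_int x / t)) * (fourier g x * cnj (fourier g x))"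
      unfolding F_def walk_prob_eq_fourier[OF k] g_def[symmetric] complex_norm_square[symmetric]
      by (simp add: scaleR_conv_of_real mult.commute)
    also have "iexp (\<xi> * (of_int x / t)) = harmonic x \<eta>"
      by (simp add: harmonic_def cis_conv_exp \<eta>_def mult.commute)
    finally show ?thesis by (simp add: fourier_shift[OF g] mult.assoc)
  qed
  have "char (walk_measure t k) \<xi> = (\<integral>x. F x \<partial>count_space UNIV)"
    unfolding char_def walk_measure_def F_def
    using nonneg by (subst integral_distr) (auto simp: integral_density)
  also have "\<dots> = infsum F UNIV"
    using infsetsum_infsum[OF F_summable] by (simp add: infsetsum_def)
  also have "\<dots> = circle_inner (\<lambda>\<theta>. g (\<theta> + \<eta>)) g"
    unfolding F by (intro infsumI parseval circle_C_L2 circle_C_shift g)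
  also have "\<dots> = 1 / (2*pi) * integral {0..2*pi} (\<lambda>\<theta>. g (\<theta> + \<eta>) * cnj (g \<theta>))"
    by (intro circle_inner_eq_integral circle_C_shift g)
  also have "(\<lambda>\<theta>. g (\<theta> + \<eta>) * cnj (g \<theta>)) = (\<lambda>\<theta>. exp (\<i> * of_real (t * (k (\<theta> + \<xi> / t) - k \<theta>))))"
    by (simp add: g_def \<eta>_def exp_cnj mult_exp_exp algebra_simps)
  finally show ?thesis .
qed

section \<open>The group velocity\<close>

text \<open>The largest absolute value of the derivative of \<open>psi s\<close>, attained at \<open>\<theta> = \<plusminus> pi / 2\<close>. The value at
  \<open>s = 0\<close> is the limit, which makes the function continuous.\<close>

definition max_speed :: "real \<Rightarrow> real" where
  "max_speed s = (if s = 0 then 1 else s / arcsin s)"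

text \<open>The derivative of \<open>psi s\<close>: the group velocity of the walk at quasi-momentum \<open>\<theta>\<close>.\<close>

definition velocity :: "real \<Rightarrow> real \<Rightarrow> real" where
  "velocity s \<theta> = - (max_speed s * sin \<theta> / sqrt (1 - (s * cos \<theta>)\<^sup>2))"

lemma scaled_cos_less_1:
  fixes s \<theta> :: real
  assumes s: "0 \<le> s" "s < 1"
  shows "\<bar>s * cos \<theta>\<bar> < 1"
proof -
  have "\<bar>s * cos \<theta>\<bar> \<le> s * 1"
    unfolding abs_mult using s by (intro mult_mono) auto
  then show ?thesis using s by simp
qed

lemma velocity_radicand_pos:
  fixes s \<theta> :: real
  assumes "0 \<le> s" "s < 1"
  shows "0 < 1 - (s * cos \<theta>)\<^sup>2"
  using scaled_cos_less_1[OF assms, of \<theta>] by (simp add: abs_square_less_1)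

lemma arcsin_pos: "0 < s \<Longrightarrow> s < 1 \<Longrightarrow> 0 < arcsin s"
  using arcsin_less_arcsin[of 0 s] by simp

lemma max_speed_pos: "0 \<le> s \<Longrightarrow> s < 1 \<Longrightarrow> 0 < max_speed s"
  using arcsin_pos[of s] by (auto simp: max_speed_def)

lemma arcsin_max_speed: "0 \<le> s \<Longrightarrow> s < 1 \<Longrightarrow> arcsin s * max_speed s = s"
  using arcsin_pos[of s] by (cases "s = 0") (auto simp: max_speed_def)

lemma psi_has_derivative:
  assumes s: "0 \<le> s" "s < 1"
  shows "(psi s has_real_derivative velocity s \<theta>) (at \<theta>)"
proof (cases "s = 0")
  case True
  then show ?thesis
    by (auto simp: psi_def[abs_def] velocity_def max_speed_def intro!: derivative_eq_intros)
next
  case False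
  have "- 1 < s * cos \<theta>" "s * cos \<theta> < 1"
    using scaled_cos_less_1[OF s, of \<theta>] by auto
  moreover have "arcsin s \<noteq> 0"
    using arcsin_pos[of s] s False by auto
  ultimately show ?thesis
    using False unfolding psi_def[abs_def] velocity_def max_speed_def
    by (auto intro!: derivative_eq_intros simp: field_simps)
qed

lemma psi_circle_C:
  assumes s: "0 \<le> s" "s < 1"
  shows "(\<lambda>\<theta>. complex_of_real (psi s \<theta>)) \<in> circle_C"
proof -
  have "continuous_on UNIV (psi s)"
    using psi_has_derivative[OF s] by (meson DERIV_isCont continuous_at_imp_continuous_on)
  then show ?thesis
    by (auto simp: circle_C_def psi_def intro: continuous_intros)
qed

text \<open>At \<open>0\<close> this is the derivative of \<open>arcsin\<close> there, which is \<open>1\<close>.\<close>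

lemma continuous_on_max_speed: "continuous_on {0..<1} max_speed"
  unfolding continuous_on_eq_continuous_within
proof
  fix s :: real assume s: "s \<in> {0..<1}"
  have "isCont max_speed s"
  proof (cases "s = 0")
    case True
    have "(arcsin has_real_derivative 1) (at 0)"
      by (auto intro!: derivative_eq_intros)
    then have "(\<lambda>h. arcsin h / h) \<midarrow>0\<rightarrow> 1"
      by (simp add: DERIV_def)
    then have "(\<lambda>h. inverse (arcsin h / h)) \<midarrow>0\<rightarrow> inverse 1"
      by (intro tendsto_inverse) auto
    then have "(\<lambda>h. inverse (arcsin h / h)) \<midarrow>0\<rightarrow> 1"
      by simp
    then have "max_speed \<midarrow>0\<rightarrow> 1"
      by (rule Lim_transform_eventually) (auto simp: eventually_at_filter max_speed_def)
    then show ?thesis using True by (simp add: isCont_def max_speed_def)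
  next
    case False
    then have "0 < s" "s < 1" using s by auto
    then have "isCont (\<lambda>s. s / arcsin s) s"
      using arcsin_pos[of s] by (intro continuous_intros isCont_arcsin) auto
    moreover have "\<forall>\<^sub>F x in nhds s. max_speed x = x / arcsin x"
      using t1_space_nhds[OF False] by eventually_elim (simp add: max_speed_def)
    ultimately show ?thesis by (simp add: isCont_cong)
  qed
  then show "continuous (at s within {0..<1}) max_speed"
    by (rule continuous_at_imp_continuous_at_within)
qed

lemma continuous_on_velocity: "continuous_on ({0..<1} \<times> UNIV) (\<lambda>(s, \<theta>). velocity s \<theta>)"
proof -
  have "sqrt (1 - (fst p * cos (snd p))\<^sup>2) \<noteq> 0" if "p \<in> {0..<1} \<times> UNIV" for p :: "real \<times> real"
    using velocity_radicand_pos[of "fst p" "snd p"] that by (auto simp: mem_Times_iff)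
  then show ?thesis
    unfolding velocity_def case_prod_unfold
    by (intro continuous_intros continuous_on_compose2[OF continuous_on_max_speed]) (auto simp: mem_Times_iff)
qed

lemma continuous_on_velocity_compose [continuous_intros]:
  assumes "continuous_on A f" "continuous_on A g" "\<And>x. x \<in> A \<Longrightarrow> f x \<in> {0..<1}"
  shows "continuous_on A (\<lambda>x. velocity (f x) (g x))"
proof -
  have "(\<lambda>x. (f x, g x)) ` A \<subseteq> {0..<1} \<times> UNIV" using assms(3) by blast
  then show ?thesis
    using continuous_on_compose2[OF continuous_on_velocity continuous_on_Pair[OF assms(1,2)]] by simp
qed

text \<open>The right-hand side makes sense, and is continuous, also at \<open>u = 0\<close>; the quotient is rewritten in
  this way to remove the apparent singularity.\<close>

lemma psi_difference_quotient:
  assumes s: "0 \<le> s" "s < 1" and u: "u > 0"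
  shows "1 / u * (psi s (\<theta> + \<xi> * u) - psi s \<theta>) = \<xi> * integral {0..1} (\<lambda>r. velocity s (\<theta> + r * \<xi> * u))"
proof -
  have int: "(\<lambda>r. velocity s (\<theta> + r * \<xi> * u)) integrable_on {0..1}"
    using s by (intro integrable_continuous_real continuous_intros) auto
  have "((\<lambda>r. psi s (\<theta> + r * \<xi> * u)) has_real_derivative velocity s (\<theta> + r * \<xi> * u) * (\<xi> * u)) (at r within {0..1})" for r
    by (rule DERIV_chain'[OF _ has_field_derivative_at_within[OF psi_has_derivative[OF s]], THEN DERIV_cong])
       (auto intro!: derivative_eq_intros)
  then have "((\<lambda>r. velocity s (\<theta> + r * \<xi> * u) * (\<xi> * u)) has_integral
     psi s (\<theta> + 1 * \<xi> * u) - psi s (\<theta> + 0 * \<xi> * u)) {0..1}"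
    by (intro fundamental_theorem_of_calculus)
       (auto simp: has_real_derivative_iff_has_vector_derivative[symmetric])
  then have "psi s (\<theta> + \<xi> * u) - psi s \<theta> = integral {0..1} (\<lambda>r. velocity s (\<theta> + r * \<xi> * u) * (\<xi> * u))"
    using integral_unique[of "\<lambda>r. velocity s (\<theta> + r * \<xi> * u) * (\<xi> * u)"] by simp
  also have "\<dots> = integral {0..1} (\<lambda>r. velocity s (\<theta> + r * \<xi> * u)) * (\<xi> * u)"
    by simp
  finally show ?thesis using u by simp
qed

section \<open>A characteristic function continuous up to infinite time\<close>

text \<open>The average of the group velocity over the segment from \<open>\<theta>\<close> to \<open>\<theta> + \<xi> u\<close>.\<close>

definition mean_velocity :: "real \<Rightarrow> real \<times> real \<Rightarrow> real \<Rightarrow> real" where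
  "mean_velocity \<xi> su \<theta> = integral {0..1} (\<lambda>r. velocity (fst su) (\<theta> + r * \<xi> * snd su))"

text \<open>The common formula for the characteristic function of \<open>mu s u\<close>, for positive \<open>u\<close> and for \<open>u = 0\<close>.\<close>

definition mu_char :: "real \<Rightarrow> real \<times> real \<Rightarrow> complex" where
  "mu_char \<xi> su = 1 / (2*pi) * integral {0..2*pi} (\<lambda>\<theta>. iexp (\<xi> * mean_velocity \<xi> su \<theta>))"

text \<open>The integrands are jointly continuous and the domains of integration compact, in both integrals.\<close>

lemma continuous_on_mu_char: "continuous_on ({0..<1} \<times> {0..}) (mu_char \<xi>)"
proof -
  let ?U = "{0..<1} \<times> {0..} :: (real \<times> real) set"
  have "continuous_on ((?U \<times> cbox 0 (2*pi)) \<times> cbox 0 1)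
     (\<lambda>(p, r). velocity (fst (fst p)) (snd p + r * \<xi> * snd (fst p)))"
    unfolding case_prod_unfold by (intro continuous_intros) auto
  then have "continuous_on (?U \<times> cbox 0 (2*pi))
      (\<lambda>p. integral (cbox 0 1) (\<lambda>r. velocity (fst (fst p)) (snd p + r * \<xi> * snd (fst p))))"
    by (rule integral_continuous_on_param)
  then have "continuous_on (?U \<times> cbox 0 (2*pi)) (\<lambda>p. mean_velocity \<xi> (fst p) (snd p))"
    by (simp add: mean_velocity_def)
  then have "continuous_on (?U \<times> cbox 0 (2*pi)) (\<lambda>(su, \<theta>). iexp (\<xi> * mean_velocity \<xi> su \<theta>))"
    unfolding case_prod_unfold by (intro continuous_intros)
  then have "continuous_on ?U (\<lambda>su. integral (cbox 0 (2*pi)) (\<lambda>\<theta>. iexp (\<xi> * mean_velocity \<xi> su \<theta>)))"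
    by (rule integral_continuous_on_param)
  then show ?thesis
    unfolding mu_char_def[abs_def] by (intro continuous_intros) simp
qed

lemma char_mu_pos:
  assumes s: "0 \<le> s" "s < 1" and u: "u > 0"
  shows "char (mu s u) \<xi> = mu_char \<xi> (s, u)"
  using u psi_difference_quotient[OF s u]
  by (simp add: mu_def char_walk_measure[OF psi_circle_C[OF s]] mu_char_def mean_velocity_def)

section \<open>The law at infinite time\<close>

text \<open>The density of the limit law in a form that covers \<open>s = 0\<close>: the factor \<open>arcsin s\<close> of the numerator
  is cancelled against the one in the last square root.\<close>

definition speed_density :: "real \<Rightarrow> real \<Rightarrow> real" where
  "speed_density s x = sqrt (1 - s\<^sup>2) / (pi * (1 - (arcsin s)\<^sup>2 * x\<^sup>2) * sqrt ((max_speed s)\<^sup>2 - x\<^sup>2))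
     * indicator {- max_speed s<..<max_speed s} x"

lemma mu_zero_density:
  assumes s: "0 \<le> s" "s < 1"
  shows "mu s 0 = density lborel (\<lambda>x. ennreal (speed_density s x))"
proof (cases "s = 0")
  case True
  then show ?thesis
    by (simp add: mu_def arcsine_measure_def speed_density_def max_speed_def)
next
  case False
  define \<rho> where "\<rho> = arcsin s"
  have \<rho>: "\<rho> > 0" using arcsin_pos[of s] False s by (auto simp: \<rho>_def)
  have c: "max_speed s = s / \<rho>" using False by (simp add: max_speed_def \<rho>_def)
  have "\<rho> * sqrt (1 - s\<^sup>2) / (pi * (1 - \<rho>\<^sup>2 * x\<^sup>2) * sqrt (s\<^sup>2 - \<rho>\<^sup>2 * x\<^sup>2)) =
     sqrt (1 - s\<^sup>2) / (pi * (1 - \<rho>\<^sup>2 * x\<^sup>2) * sqrt ((s / \<rho>)\<^sup>2 - x\<^sup>2))" for x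
  proof -
    have "s\<^sup>2 - \<rho>\<^sup>2 * x\<^sup>2 = \<rho>\<^sup>2 * ((s / \<rho>)\<^sup>2 - x\<^sup>2)"
      using \<rho> by (simp add: power_divide right_diff_distrib)
    then have "sqrt (s\<^sup>2 - \<rho>\<^sup>2 * x\<^sup>2) = \<rho> * sqrt ((s / \<rho>)\<^sup>2 - x\<^sup>2)"
      using \<rho> by (simp add: real_sqrt_mult)
    then show ?thesis using \<rho> by simp
  qed
  then show ?thesis
    using False s by (simp add: mu_def limit_measure_def speed_density_def c \<rho>_def[symmetric])
qed

text \<open>Half of the circle is enough: \<open>velocity s\<close> changes sign under \<open>\<theta> \<mapsto> \<theta> + pi\<close> and under
  \<open>\<theta> \<mapsto> - \<theta>\<close>, and on this half it is injective, so that the substitution rule applies.\<close>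

definition uniform_half_circle :: "real measure" where
  "uniform_half_circle = density lborel (\<lambda>\<theta>. ennreal (1 / pi * indicator {- (pi / 2)..pi / 2} \<theta>))"

lemma prob_space_uniform_half_circle: "prob_space uniform_half_circle"
proof (rule prob_spaceI)
  have "emeasure uniform_half_circle (space uniform_half_circle)
     = (\<integral>\<^sup>+\<theta>. ennreal (1 / pi) * indicator {- (pi / 2)..pi / 2} \<theta> \<partial>lborel)"
    unfolding uniform_half_circle_def
    by (auto simp: emeasure_density intro!: nn_integral_cong split: split_indicator)
  also have "\<dots> = ennreal (1 / pi) * ennreal pi"
    by (subst nn_integral_cmult_indicator) (auto simp: field_simps)
  also have "\<dots> = 1" by (simp flip: ennreal_mult)
  finally show "emeasure uniform_half_circle (space uniform_half_circle) = 1" .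
qed

text \<open>With \<open>D = 1 - s\<^sup>2 cos\<^sup>2 \<theta>\<close>, \<open>c = max_speed s\<close> and \<open>x = c sin \<theta> / \<surd>D\<close>, everything follows from
  \<open>D - s\<^sup>2 sin\<^sup>2 \<theta> = 1 - s\<^sup>2\<close>: this identity gives \<open>1 - (arcsin s)\<^sup>2 x\<^sup>2 = (1 - s\<^sup>2) / D\<close> and, together with
  \<open>D - sin\<^sup>2 \<theta> = (1 - s\<^sup>2) cos\<^sup>2 \<theta>\<close>, also \<open>c\<^sup>2 - x\<^sup>2 = c\<^sup>2 cos\<^sup>2 \<theta> (1 - s\<^sup>2) / D\<close>. The density times the
  Jacobian is then constant.\<close>

lemma velocity_substitution:
  assumes s: "0 \<le> s" "s < 1"
  defines "D \<equiv> \<lambda>\<theta>. 1 - (s * cos \<theta>)\<^sup>2"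
  defines "v' \<equiv> \<lambda>\<theta>. max_speed s * cos \<theta> * (1 - s\<^sup>2) / (D \<theta> * sqrt (D \<theta>))"
  shows "((\<lambda>\<theta>. - velocity s \<theta>) has_real_derivative v' \<theta>) (at \<theta>)"
    and "\<bar>\<theta>\<bar> < pi / 2 \<Longrightarrow> speed_density s (- velocity s \<theta>) * v' \<theta> = 1 / pi"
proof -
  have D: "0 < D \<theta>" unfolding D_def by (rule velocity_radicand_pos[OF s])
  define R where "R = sqrt (D \<theta>)"
  have R: "R > 0" "R\<^sup>2 = D \<theta>" using D by (auto simp: R_def)
  define c where "c = max_speed s"
  have c: "c > 0" "arcsin s * c = s" unfolding c_def using max_speed_pos arcsin_max_speed s by auto
  have key: "D \<theta> - s\<^sup>2 * (sin \<theta>)\<^sup>2 = 1 - s\<^sup>2"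
    unfolding D_def by (simp add: power_mult_distrib cos_squared_eq algebra_simps)
  have "((\<lambda>\<theta>. c * sin \<theta> / sqrt (D \<theta>)) has_real_derivative
     (c * cos \<theta> * R - c * sin \<theta> * ((2 * s\<^sup>2 * cos \<theta> * sin \<theta>) / (2 * R))) / (R * R)) (at \<theta>)"
  proof -
    have "(D has_real_derivative 2 * s\<^sup>2 * cos \<theta> * sin \<theta>) (at \<theta>)"
      unfolding D_def by (auto intro!: derivative_eq_intros simp: power2_eq_square)
    then have "((\<lambda>\<theta>. sqrt (D \<theta>)) has_real_derivative (2 * s\<^sup>2 * cos \<theta> * sin \<theta>) / (2 * R)) (at \<theta>)"
      using D unfolding R_def by (auto intro!: derivative_eq_intros simp: field_simps)
    then show ?thesis
      using R(1) unfolding R_def by (intro DERIV_divide[OF DERIV_cmult[OF DERIV_sin]]) auto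
  qed
  also have "(c * cos \<theta> * R - c * sin \<theta> * ((2 * s\<^sup>2 * cos \<theta> * sin \<theta>) / (2 * R))) / (R * R)
     = c * cos \<theta> * (R\<^sup>2 - s\<^sup>2 * (sin \<theta>)\<^sup>2) / (R\<^sup>2 * R)"
    using R(1) by (simp add: field_simps power2_eq_square)
  also have "\<dots> = v' \<theta>"
    unfolding R(2) key by (simp add: v'_def c_def R_def)
  finally show "((\<lambda>\<theta>. - velocity s \<theta>) has_real_derivative v' \<theta>) (at \<theta>)"
    by (simp add: velocity_def c_def D_def)
  assume \<theta>: "\<bar>\<theta>\<bar> < pi / 2"
  then have cos: "cos \<theta> > 0" by (intro cos_gt_zero_pi) auto
  define g where "g = - velocity s \<theta>"
  have g: "g = c * sin \<theta> / R" by (simp add: g_def velocity_def c_def R_def D_def)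
  define q where "q = sqrt (1 - s\<^sup>2)"
  have q: "q > 0" "q\<^sup>2 = 1 - s\<^sup>2"
    using s by (auto simp: q_def abs_square_less_1 power_le_one)
  have A: "c\<^sup>2 - g\<^sup>2 = (c * cos \<theta> * q / R)\<^sup>2"
  proof -
    have "c\<^sup>2 - g\<^sup>2 = c\<^sup>2 * (R\<^sup>2 - (sin \<theta>)\<^sup>2) / R\<^sup>2"
      using R(1) by (simp add: g power_divide power_mult_distrib field_simps)
    also have "R\<^sup>2 - (sin \<theta>)\<^sup>2 = (cos \<theta>)\<^sup>2 * q\<^sup>2"
      unfolding R(2) q(2) D_def by (simp add: power_mult_distrib sin_squared_eq algebra_simps)
    finally show ?thesis by (simp add: power_divide power_mult_distrib)
  qed
  then have sq: "sqrt (c\<^sup>2 - g\<^sup>2) = c * cos \<theta> * q / R"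
    using c cos q R by simp
  have "c\<^sup>2 - g\<^sup>2 > 0" unfolding A using c cos q R by simp
  then have "\<bar>g\<bar> < c" using c by (simp add: abs_less_iff power2_less_imp_less flip: abs_le_square_iff) 
  then have ind: "indicator {- c<..<c} g = (1::real)" by (auto simp: abs_less_iff)
  have B: "1 - (arcsin s)\<^sup>2 * g\<^sup>2 = q\<^sup>2 / R\<^sup>2"
  proof -
    have "(arcsin s)\<^sup>2 * g\<^sup>2 = (arcsin s * c)\<^sup>2 * (sin \<theta>)\<^sup>2 / R\<^sup>2"
      by (simp add: g power_divide power_mult_distrib)
    then show ?thesis
      using D key unfolding c(2) q(2) R(2) by (simp add: field_simps)
  qed
  have "speed_density s g = q / (pi * (q\<^sup>2 / R\<^sup>2) * (c * cos \<theta> * q / R))"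
    unfolding speed_density_def c_def[symmetric] q_def[symmetric] B sq ind by simp
  moreover have "v' \<theta> = c * cos \<theta> * q\<^sup>2 / (R\<^sup>2 * R)"
    by (simp add: v'_def q(2) R(2) c_def) (simp add: R_def)
  ultimately have "speed_density s g * v' \<theta>
      = q / (pi * (q\<^sup>2 / R\<^sup>2) * (c * cos \<theta> * q / R)) * (c * cos \<theta> * q\<^sup>2 / (R\<^sup>2 * R))"
    by (simp only:)
  also have "\<dots> = 1 / pi"
    using q(1) R(1) c(1) cos by (simp add: field_simps power2_eq_square)
  finally show "speed_density s (- velocity s \<theta>) * v' \<theta> = 1 / pi"
    by (simp add: g_def)
qed

text \<open>The law at \<open>u = 0\<close> is that of the group velocity at a uniformly random quasi-momentum.\<close>

lemma mu_zero_eq_distr: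
  assumes s: "0 \<le> s" "s < 1"
  shows "mu s 0 = distr uniform_half_circle borel (\<lambda>\<theta>. - velocity s \<theta>)"
proof (rule measure_eqI)
  show "sets (mu s 0) = sets (distr uniform_half_circle borel (\<lambda>\<theta>. - velocity s \<theta>))"
    by (simp add: mu_zero_density[OF s])
  fix B assume "B \<in> sets (mu s 0)"
  then have B [measurable]: "B \<in> sets borel" by (simp add: mu_zero_density[OF s])
  define g where "g = (\<lambda>\<theta>. - velocity s \<theta>)"
  define c where "c = max_speed s"
  define v' where "v' = (\<lambda>\<theta>. max_speed s * cos \<theta> * (1 - s\<^sup>2) / ((1 - (s * cos \<theta>)\<^sup>2) * sqrt (1 - (s * cos \<theta>)\<^sup>2)))"
  have deriv: "(g has_real_derivative v' \<theta>) (at \<theta>)" for \<theta>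
    unfolding g_def v'_def by (rule velocity_substitution(1)[OF s])
  have jacobian: "speed_density s (g \<theta>) * v' \<theta> = 1 / pi" if "\<bar>\<theta>\<bar> < pi / 2" for \<theta>
    unfolding g_def v'_def by (rule velocity_substitution(2)[OF s that])
  have [measurable]: "speed_density s \<in> borel_measurable borel"
    unfolding speed_density_def[abs_def] by measurable
  have gm [measurable]: "g \<in> borel_measurable borel"
    unfolding g_def velocity_def by measurable
  have ge: "g (- (pi / 2)) = - c" "g (pi / 2) = c"
    by (simp_all add: g_def velocity_def c_def)
  have v'_cont: "continuous_on {- (pi / 2)..pi / 2} v'"
    unfolding v'_def
  proof (intro continuous_intros ballI)
    fix \<theta> :: real
    show "(1 - (s * cos \<theta>)\<^sup>2) * sqrt (1 - (s * cos \<theta>)\<^sup>2) \<noteq> 0"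
      using velocity_radicand_pos[OF s, of \<theta>] by auto
  qed
  have v'_nonneg: "v' \<theta> \<ge> 0" if "\<theta> \<in> {- (pi / 2)..pi / 2}" for \<theta>
    unfolding v'_def using velocity_radicand_pos[OF s, of \<theta>] max_speed_pos[OF s] that s
    by (intro divide_nonneg_nonneg mult_nonneg_nonneg cos_ge_zero) (auto simp: power_le_one)
  have "emeasure (mu s 0) B = (\<integral>\<^sup>+x. ennreal (speed_density s x) * indicator B x \<partial>lborel)"
    by (simp add: mu_zero_density[OF s] emeasure_density)
  \<comment> \<open>The density vanishes outside the range of \<open>g\<close>, so the cut-off that the substitution needs is free.\<close>
  also have "\<dots> = (\<integral>\<^sup>+x. ennreal (speed_density s x * indicator B x * indicator {g (- (pi / 2))..g (pi / 2)} x) \<partial>lborel)"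
    unfolding ge by (intro nn_integral_cong) (auto simp: speed_density_def c_def split: split_indicator)
  also have "\<dots> = (\<integral>\<^sup>+\<theta>. ennreal (speed_density s (g \<theta>) * indicator B (g \<theta>) * v' \<theta> * indicator {- (pi / 2)..pi / 2} \<theta>) \<partial>lborel)"
    by (rule nn_integral_substitution)
       (auto simp: set_borel_measurable_def intro: deriv v'_cont v'_nonneg)
  also have "\<dots> = (\<integral>\<^sup>+\<theta>. ennreal (1 / pi * indicator {- (pi / 2)..pi / 2} \<theta>) * indicator (g -` B) \<theta> \<partial>lborel)"
  proof (rule nn_integral_cong_AE)
    \<comment> \<open>The two endpoints, where the density is cut off, form a null set.\<close>
    have "AE \<theta> in lborel. \<theta> \<noteq> - (pi / 2)" "AE \<theta> in lborel. \<theta> \<noteq> pi / 2"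
      by (rule AE_lborel_singleton)+
    then show "AE \<theta> in lborel. ennreal (speed_density s (g \<theta>) * indicator B (g \<theta>) * v' \<theta> * indicator {- (pi / 2)..pi / 2} \<theta>)
        = ennreal (1 / pi * indicator {- (pi / 2)..pi / 2} \<theta>) * indicator (g -` B) \<theta>"
    proof eventually_elim
      case (elim \<theta>)
      show ?case
      proof (cases "\<theta> \<in> {- (pi / 2)..pi / 2}")
        case True
        then have "speed_density s (g \<theta>) * v' \<theta> = 1 / pi"
          using elim by (intro jacobian) auto
        then show ?thesis using True by (auto split: split_indicator)
      qed auto
    qed
  qed
  also have "\<dots> = emeasure (distr uniform_half_circle borel g) B"
    using measurable_sets[OF gm B]
    by (subst emeasure_distr) (auto simp: uniform_half_circle_def emeasure_density)
  finally show "emeasure (mu s 0) B = emeasure (distr uniform_half_circle borel (\<lambda>\<theta>. - velocity s \<theta>)) B"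
    by (simp add: g_def)
qed

lemma velocity_measurable [measurable]: "velocity s \<in> borel_measurable borel"
  unfolding velocity_def[abs_def] by measurable

section \<open>Continuity in the weak topology\<close>

lemma mu_real_distribution:
  assumes s: "0 \<le> s" "s < 1" and u: "0 \<le> u"
  shows "real_distribution (mu s u)"
proof (cases "u = 0")
  case True
  show ?thesis
    unfolding True mu_zero_eq_distr[OF s]
    by (intro prob_space.real_distribution_distr prob_space_uniform_half_circle)
       (auto simp: uniform_half_circle_def)
next
  case False
  then show ?thesis
    using u by (simp add: mu_def walk_measure_real_distribution psi_circle_C s)
qed

text \<open>The circle is cut into the half around \<open>0\<close> and the half around \<open>pi\<close>. By the symmetries of the
  group velocity both contribute the same integral.\<close>

lemma char_mu_zero:
  assumes s: "0 \<le> s" "s < 1"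
  shows "char (mu s 0) \<xi> = mu_char \<xi> (s, 0)"
proof -
  define f where "f = (\<lambda>\<theta>. iexp (\<xi> * velocity s \<theta>))"
  have fc: "continuous_on A f" for A
    unfolding f_def by (intro continuous_intros) (use s in auto)
  have int: "f integrable_on {a..b}" for a b
    using fc by (rule integrable_continuous_real)
  have fC: "f \<in> circle_C"
    using fc by (simp add: circle_C_def f_def velocity_def)
  define h where "h = (\<lambda>\<theta>. f (- \<theta>))"
  have h: "h = (\<lambda>\<theta>. iexp (\<xi> * - velocity s \<theta>))"
    by (simp add: h_def f_def velocity_def)
  have hc: "continuous_on A h" for A
    unfolding h by (intro continuous_intros) (use s in auto)
  have shift: "integral {a..b} (\<lambda>\<theta>. f (\<theta> + c)) = integral {a+c..b+c} f" for a b c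
    using integral_shift_Icc_real[of a b f c] by (simp add: o_def add.commute)
  have "integral {0..2*pi} f = integral {0..2*pi} (\<lambda>\<theta>. f (\<theta> + - (pi / 2)))"
    by (rule circle_C_integral_shift[OF fC, symmetric])
  also have "\<dots> = integral {- (pi / 2)..3*pi/2} f"
    unfolding shift by (simp add: algebra_simps)
  also have "\<dots> = integral {- (pi / 2)..pi/2} f + integral {pi/2..3*pi/2} f"
    by (intro Henstock_Kurzweil_Integration.integral_combine[symmetric] int) auto
  also have "integral {pi/2..3*pi/2} f = integral {- (pi / 2)..pi/2} (\<lambda>\<theta>. f (\<theta> + pi))"
    unfolding shift by (simp add: algebra_simps)
  also have "(\<lambda>\<theta>. f (\<theta> + pi)) = h"
    by (simp add: h f_def velocity_def)
  also have "integral {- (pi / 2)..pi/2} f = integral {- (pi / 2)..pi/2} h"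
    unfolding h_def using Henstock_Kurzweil_Integration.integral_reflect_real[of "pi/2" "- (pi / 2)" f] by simp
  finally have eq: "integral {0..2*pi} f = 2 * integral {- (pi / 2)..pi/2} h" by simp
  have "char (mu s 0) \<xi> = (\<integral>\<theta>. h \<theta> \<partial>uniform_half_circle)"
    unfolding char_def mu_zero_eq_distr[OF s] h
    by (subst integral_distr) (auto simp: uniform_half_circle_def)
  also have "\<dots> = (\<integral>\<theta>. (1 / pi * indicator {- (pi / 2)..pi/2} \<theta>) *\<^sub>R h \<theta> \<partial>lborel)"
  proof -
    have "h \<in> borel_measurable lborel" using hc by (auto intro: borel_measurable_continuous_onI)
    then show ?thesis
      unfolding uniform_half_circle_def by (subst integral_density) auto
  qed
  also have "\<dots> = (LINT \<theta>:{- (pi / 2)..pi / 2}|lborel. (1 / pi) *\<^sub>R h \<theta>)"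
    unfolding set_lebesgue_integral_def scaleR_scaleR by (simp only: mult.commute)
  also have "\<dots> = (1 / pi) *\<^sub>R set_lebesgue_integral lborel {- (pi / 2)..pi / 2} h"
    by (rule set_integral_scaleR_right)
  also have "\<dots> = (1 / pi) *\<^sub>R integral {- (pi / 2)..pi/2} h"
    by (subst set_borel_integral_eq_integral(2)) (auto intro: borel_integrable_atLeastAtMost' hc)
  also have "\<dots> = 1 / (2*pi) * integral {0..2*pi} f"
    by (simp add: eq scaleR_conv_of_real)
  also have "\<dots> = mu_char \<xi> (s, 0)"
    by (simp add: mu_char_def mean_velocity_def f_def)
  finally show ?thesis .
qed

lemma char_mu:
  assumes "0 \<le> s" "s < 1" "0 \<le> u"
  shows "char (mu s u) \<xi> = mu_char \<xi> (s, u)"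
  using assms char_mu_zero char_mu_pos by (cases "u = 0") auto

text \<open>Continuity of the characteristic functions becomes weak convergence along every sequence by Levy's
  continuity theorem, and sequences detect continuity on a subset of the plane.\<close>

lemma continuous_on_mu_integral:
  fixes f :: "real \<Rightarrow> real"
  assumes f: "continuous_on UNIV f" "bounded (range f)"
  shows "continuous_on ({0..<1} \<times> {0..}) (\<lambda>(s, u). \<integral>x. f x \<partial>mu s u)"
proof (rule continuous_on_sequentiallyI)
  fix X :: "nat \<Rightarrow> real \<times> real" and a
  assume X: "\<forall>n. X n \<in> {0..<1} \<times> {0..}" and a: "a \<in> {0..<1} \<times> {0..}" and lim: "X \<longlonglongrightarrow> a"
  define M where "M = (\<lambda>p. mu (fst p) (snd p))"
  have rd: "real_distribution (M p)" if "p \<in> {0..<1} \<times> {0..}" for p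
    using that by (auto simp: M_def mem_Times_iff intro: mu_real_distribution)
  have ch: "char (M p) \<xi> = mu_char \<xi> p" if "p \<in> {0..<1} \<times> {0..}" for p \<xi>
    using that char_mu[of "fst p" "snd p" \<xi>] by (auto simp: M_def mem_Times_iff)
  have "(\<lambda>n. char (M (X n)) \<xi>) \<longlonglongrightarrow> char (M a) \<xi>" for \<xi>
    using continuous_on_mu_char[of \<xi>] X a lim ch
    by (auto simp: continuous_on_sequentially o_def)
  then have "weak_conv_m (\<lambda>n. M (X n)) (M a)"
    using X a rd by (intro levy_continuity) auto
  moreover obtain B where "\<And>x. norm (f x) \<le> B"
    using f(2) by (auto simp: bounded_iff)
  moreover have "isCont f x" for x
    using f(1) by (simp add: continuous_on_eq_continuous_at)
  ultimately have "(\<lambda>n. \<integral>x. f x \<partial>M (X n)) \<longlonglongrightarrow> (\<integral>x. f x \<partial>M a)"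
    using X a rd by (intro weak_conv_imp_integral_bdd_continuous_conv) auto
  then show "(\<lambda>n. case X n of (s, u) \<Rightarrow> \<integral>x. f x \<partial>mu s u) \<longlonglongrightarrow> (case a of (s, u) \<Rightarrow> \<integral>x. f x \<partial>mu s u)"
    by (simp add: M_def case_prod_unfold)
qed

text \<open>The weak topology is generated by preimages of open sets under the integrals of bounded continuous
  functions, so only these integrals have to be continuous.\<close>

lemma continuous_map_weak_topology:
  fixes S :: "'a::topological_space set"
  assumes M: "\<And>x. x \<in> S \<Longrightarrow> M x \<in> borel_prob_measures"
    and cont: "\<And>f::real \<Rightarrow> real. continuous_on UNIV f \<Longrightarrow> bounded (range f) \<Longrightarrow> continuous_on S (\<lambda>x. \<integral>y. f y \<partial>M x)"
  shows "continuous_map (top_of_set S) weak_topology M"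
  unfolding weak_topology_def
proof (rule continuous_on_generated_topo, goal_cases)
  case (1 W)
  then obtain f U where W: "W = {M \<in> borel_prob_measures. (\<integral>x. f x \<partial>M) \<in> U}"
    and f: "continuous_on UNIV f" "bounded (range f)" and U: "open (U :: real set)" by blast
  have "openin (top_of_set S) (S \<inter> (\<lambda>x. \<integral>y. f y \<partial>M x) -` U)"
    using cont[OF f] U by (rule continuous_openin_preimage_gen)
  moreover have "M -` W \<inter> topspace (top_of_set S) = S \<inter> (\<lambda>x. \<integral>y. f y \<partial>M x) -` U"
    using M by (auto simp: W)
  ultimately show ?case by simp
next
  case 2
  then show ?case
    using M topspace_weak_topology
    by (auto simp: weak_topology_def topology_generated_by_topspace)
qed

theorem theorem3:
  shows "continuous_map (top_of_set ({0..<1} \<times> {0..})) weak_topology (\<lambda>(s, u). mu s u) \<and>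
    limitin weak_topology (\<lambda>(s, t). walk_measure t (psi s)) arcsine_measure
      (filtercomap (\<lambda>(s, t). (s, 1 / t)) (at (0, 0) within {0..<1} \<times> {0<..}))"
proof
  let ?D = "{0..<1} \<times> {0..} :: (real \<times> real) set"
  show cont: "continuous_map (top_of_set ?D) weak_topology (\<lambda>(s, u). mu s u)"
  proof (rule continuous_map_weak_topology)
    show "(case p of (s, u) \<Rightarrow> mu s u) \<in> borel_prob_measures" if "p \<in> ?D" for p
      using that mu_real_distribution
      by (auto simp: borel_prob_measures_def real_distribution_def real_distribution_axioms_def)
    show "continuous_on ?D (\<lambda>p. \<integral>y. f y \<partial>(case p of (s, u) \<Rightarrow> mu s u))"
      if "continuous_on UNIV f" "bounded (range f)" for f :: "real \<Rightarrow> real"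
      using continuous_on_mu_integral[OF that] by (simp add: case_prod_unfold)
  qed
  have mu0: "mu 0 0 = arcsine_measure" by (simp add: mu_def)
  show "limitin weak_topology (\<lambda>(s, t). walk_measure t (psi s)) arcsine_measure
      (filtercomap (\<lambda>(s, t). (s, 1 / t)) (at (0, 0) within {0..<1} \<times> {0<..}))"
    unfolding limitin_def
  proof (intro conjI allI impI)
    show "arcsine_measure \<in> topspace weak_topology"
      using continuous_map_image_subset_topspace[OF cont] mu0 by (force simp: image_subset_iff)
    fix W assume W: "openin weak_topology W \<and> arcsine_measure \<in> W"
    have "openin (top_of_set ?D) {p \<in> topspace (top_of_set ?D). (case p of (s, u) \<Rightarrow> mu s u) \<in> W}"
      using W by (intro openin_continuous_map_preimage[OF cont]) auto
    then obtain T where T: "open T" "{p \<in> ?D. (case p of (s, u) \<Rightarrow> mu s u) \<in> W} = ?D \<inter> T"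
      unfolding openin_open topspace_euclidean_subtopology by blast
    have "(0, 0) \<in> {p \<in> ?D. (case p of (s, u) \<Rightarrow> mu s u) \<in> W}"
      using W mu0 by simp
    then have "(0, 0) \<in> T" unfolding T(2) by simp
    then have "\<forall>\<^sub>F p in at (0, 0) within {0..<1} \<times> {0<..}. p \<in> T \<and> p \<in> {0..<1} \<times> {0<..}"
      using T(1) by (auto simp: eventually_at_filter eventually_nhds)
    then have "\<forall>\<^sub>F p in at (0, 0) within {0..<1} \<times> {0<..}. snd p > 0 \<and> mu (fst p) (snd p) \<in> W"
    proof eventually_elim
      case (elim p)
      then have "p \<in> ?D \<inter> T" by auto
      then show ?case unfolding T(2)[symmetric] using elim by (auto simp: case_prod_unfold)
    qed
    then have "\<forall>\<^sub>F st in filtercomap (\<lambda>(s, t). (s, 1 / t)) (at (0, 0) within {0..<1} \<times> {0<..}).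
        1 / snd st > 0 \<and> mu (fst st) (1 / snd st) \<in> W"
      by (auto simp: case_prod_unfold dest: eventually_filtercomapI[where f = "\<lambda>(s, t). (s, 1 / t)"])
    then show "\<forall>\<^sub>F st in filtercomap (\<lambda>(s, t). (s, 1 / t)) (at (0, 0) within {0..<1} \<times> {0<..}).
        (case st of (s, t) \<Rightarrow> walk_measure t (psi s)) \<in> W"
      by eventually_elim (auto simp: mu_def)
  qed
qed

end
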